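(* Let $A$ be a generalized Cartan matrix with associated data $\mathfrak h_{\mathbb R}^*,\Pi,W,\overline C$, let $\mu\in\overline C$, and let $I\subseteq\Pi$ be $\mu$-connected. Let $F_I$ be the convex hull of $W_I\mu$. Then $\operatorname{ri}(F_I)=W_I\,(\operatorname{ri}(F_I)\cap\overline C)$ and $$\operatorname{ri}(F_I)\cap\overline C=(\mu-\mathbb R_{>}I)\cap\overline C=\bigsqcup_{I_f\subseteq I,\ (I_f)^0=I_f}(\mu-\mathbb R_{>}I)\cap C_{I_*\cup I_f},$$ where the union is disjoint and every set $(\mu-\mathbb R_{>}I)\cap C_{I_*\cup I_f}$ occurring in it is nonempty.
   Context: Let $A=(a_{ij})_{i,j=1}^m$ be a generalized Cartan matrix (integral, $a_{ii}=2$, $a_{ij}\le 0$ for $i\ne j$, $a_{ij}=0\Rightarrow a_{ji}=0$) of rank $l$. Let $(\mathfrak h_{\mathbb R},\Pi,\Pi^\vee)$ be a realization of $A$ over $\mathbb R$: $\mathfrak h_{\mathbb R}$ is a real vector space of dimension $2m-l$, and $\Pi=\{\alpha_1,\dots,\alpha_m\}\subset\mathfrak h_{\mathbb R}^*$ and $\Pi^\vee=\{\alpha_1^\vee,\dots,\alpha_m^\vee\}\subset\mathfrak h_{\mathbb R}$ are linearly independent with $\langle\alpha_j,\alpha_i^\vee\rangle=a_{ij}$. The Weyl group $W\subset GL(\mathfrak h_{\mathbb R}^* )$ is generated by the reflections $r_{\alpha_i}(\eta)=\eta-\langle\eta,\alpha_i^\vee\rangle\alpha_i$. For $I\subseteq\Pi$,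 $W_I$ is the subgroup generated by $r_\alpha$, $\alpha\in I$. The fundamental chamber is $\overline C=\{\eta\in\mathfrak h_{\mathbb R}^*\mid\langle\eta,\alpha^\vee\rangle\ge 0\ \forall\alpha\in\Pi\}$. For $J\subseteq\Pi$, $C_J=\{\eta\mid\langle\eta,\alpha^\vee\rangle=0\ \forall\alpha\in J,\ \langle\eta,\alpha^\vee\rangle>0\ \forall\alpha\in\Pi\setminus J\}$. Fix $\mu\in\overline C$ and set $J_0=\{\alpha\in\Pi\mid\langle\mu,\alpha^\vee\rangle=0\}$. Connected components of a subset of $\Pi$ are taken in the Dynkin diagram of $A$ (distinct $\alpha,\beta\in\Pi$ are adjacent iff $\langle\alpha,\beta^\vee\rangle\ne 0$). A subset $I\subseteq\Pi$ is $\mu$-connected if no connected component of $I$ is contained in $J_0$ (the empty set is $\mu$-connected). For $\mu$-connected $I$, $I_*=\{\alpha\in J_0\setminus I\mid r_\alpha r_\beta=r_\beta r_\alpha\ \forall\beta\in I\}$. For $K\subseteq\Pi$, $K^0$ is the union of those connected components of $K$ whose generalized Cartan submatrix is of finite type ($\emptyset^0=\emptyset$). $\mathbb R_{>}I=\{\sum_{\alpha\in I}m_\alpha\alpha\mid m_\alpha>0\ \forall\alpha\in I\}$, with $\mathbb R_{>}\emptyset=\{0\}$. $\operatorname{ri}$ denotes the relative interior of a convex set. *)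

theory Defs
  imports "HOL-Analysis.Analysis" "HOL-Algebra.Generated_Groups"
begin

definition gen_cartan_matrix :: "int^'n^'n \<Rightarrow> bool" where
  "gen_cartan_matrix A \<longleftrightarrow>
     (\<forall>i. A $ i $ i = 2) \<and>
     (\<forall>i j. i \<noteq> j \<longrightarrow> A $ i $ j \<le> 0) \<and>
     (\<forall>i j. A $ i $ j = 0 \<longrightarrow> A $ j $ i = 0)"

text \<open>
  The dual space of \<open>'h\<close> is represented by a type \<open>'v\<close> together with an evaluation pairing
  \<open>p\<close> such that \<open>\<eta> \<mapsto> p \<eta>\<close> is a linear isomorphism from \<open>'v\<close> onto the space of
  linear functionals on \<open>'h\<close>.
\<close>

definition dual_pairing :: "('v::real_vector \<Rightarrow> 'h::real_vector \<Rightarrow> real) \<Rightarrow> bool" where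
  "dual_pairing p \<longleftrightarrow> (\<forall>h. linear (\<lambda>\<eta>. p \<eta> h)) \<and> bij_betw p UNIV {f. linear f}"

text \<open>
  Simple roots \<open>a\<close> and simple coroots \<open>c\<close> are families indexed by \<open>'n\<close>; linear
  independence includes injectivity, so subsets of the set of simple roots correspond to
  sets of indices. The prescribed dimension \<open>2m - l\<close> is positive, which forces \<open>'h\<close> to be
  finite-dimensional since \<open>dim\<close> is \<open>0\<close> on infinite-dimensional spaces.
\<close>

definition realization ::
  "int^'n^'n \<Rightarrow> ('v::real_vector \<Rightarrow> 'h::real_vector \<Rightarrow> real) \<Rightarrow> ('n \<Rightarrow> 'v) \<Rightarrow> ('n \<Rightarrow> 'h) \<Rightarrow> bool" where
  "realization A p a c \<longleftrightarrow>
     dual_pairing p \<and>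
     dim (UNIV :: 'h set) = 2 * CARD('n) - rank (\<chi> i j. real_of_int (A $ i $ j)) \<and>
     inj a \<and> independent (range a) \<and>
     inj c \<and> independent (range c) \<and>
     (\<forall>i j. p (a j) (c i) = real_of_int (A $ i $ j))"

definition reflection ::
  "('v::real_vector \<Rightarrow> 'h \<Rightarrow> real) \<Rightarrow> ('n \<Rightarrow> 'v) \<Rightarrow> ('n \<Rightarrow> 'h) \<Rightarrow> 'n \<Rightarrow> 'v \<Rightarrow> 'v" where
  "reflection p a c i \<eta> = \<eta> - p \<eta> (c i) *\<^sub>R a i"

definition general_linear_group :: "('v::real_vector \<Rightarrow> 'v) monoid" where
  "general_linear_group = \<lparr>carrier = {f. linear f \<and> bij f}, mult = (\<circ>), one = id\<rparr>"

definition weyl_subgroup ::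
  "('v::real_vector \<Rightarrow> 'h \<Rightarrow> real) \<Rightarrow> ('n \<Rightarrow> 'v) \<Rightarrow> ('n \<Rightarrow> 'h) \<Rightarrow> 'n set \<Rightarrow> ('v \<Rightarrow> 'v) set" where
  "weyl_subgroup p a c K = generate general_linear_group (reflection p a c ` K)"

definition fundamental_chamber :: "('v \<Rightarrow> 'h \<Rightarrow> real) \<Rightarrow> ('n \<Rightarrow> 'h) \<Rightarrow> 'v set" where
  "fundamental_chamber p c = {\<eta>. \<forall>i. 0 \<le> p \<eta> (c i)}"

definition chamber_face :: "('v \<Rightarrow> 'h \<Rightarrow> real) \<Rightarrow> ('n \<Rightarrow> 'h) \<Rightarrow> 'n set \<Rightarrow> 'v set" where
  "chamber_face p c J = {\<eta>. (\<forall>i\<in>J. p \<eta> (c i) = 0) \<and> (\<forall>i\<in>- J. 0 < p \<eta> (c i))}"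

definition zero_set :: "('v \<Rightarrow> 'h \<Rightarrow> real) \<Rightarrow> ('n \<Rightarrow> 'h) \<Rightarrow> 'v \<Rightarrow> 'n set" where
  "zero_set p c \<mu> = {i. p \<mu> (c i) = 0}"

definition dynkin_adj :: "int^'n^'n \<Rightarrow> ('n \<times> 'n) set" where
  "dynkin_adj A = {(i, j). i \<noteq> j \<and> A $ j $ i \<noteq> 0}"

definition components :: "int^'n^'n \<Rightarrow> 'n set \<Rightarrow> 'n set set" where
  "components A K = K // (Restr (dynkin_adj A) K)\<^sup>*"

definition mu_connected ::
  "int^'n^'n \<Rightarrow> ('v \<Rightarrow> 'h \<Rightarrow> real) \<Rightarrow> ('n \<Rightarrow> 'h) \<Rightarrow> 'v \<Rightarrow> 'n set \<Rightarrow> bool" where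
  "mu_connected A p c \<mu> K \<longleftrightarrow> (\<forall>L\<in>components A K. \<not> L \<subseteq> zero_set p c \<mu>)"

definition star_set ::
  "('v::real_vector \<Rightarrow> 'h \<Rightarrow> real) \<Rightarrow> ('n \<Rightarrow> 'v) \<Rightarrow> ('n \<Rightarrow> 'h) \<Rightarrow> 'v \<Rightarrow> 'n set \<Rightarrow> 'n set" where
  "star_set p a c \<mu> K =
     {i \<in> zero_set p c \<mu> - K.
        \<forall>j\<in>K. reflection p a c i \<circ> reflection p a c j = reflection p a c j \<circ> reflection p a c i}"

text \<open>The Leibniz formula for the determinant of the submatrix with rows and columns in \<open>K\<close>.\<close>

definition principal_minor :: "int^'n^'n \<Rightarrow> 'n::finite set \<Rightarrow> int" where
  "principal_minor A K = (\<Sum>q | q permutes K. sign q * (\<Prod>i\<in>K. A $ i $ q i))"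

text \<open>
  Kac's definition (Infinite dimensional Lie algebras, Theorem 4.3, case Fin) of finite type
  for the submatrix \<open>B\<close> of \<open>A\<close> with rows and columns in \<open>K\<close>: \<open>det B \<noteq> 0\<close>; there is
  \<open>u > 0\<close> with \<open>B u > 0\<close>; and \<open>B v \<ge> 0\<close> implies \<open>v > 0\<close> or \<open>v = 0\<close>.
  Vector inequalities are entrywise. The definition is meant for indecomposable \<open>B\<close>, that is,
  for connected \<open>K\<close>.
\<close>

definition finite_type :: "int^'n^'n \<Rightarrow> 'n::finite set \<Rightarrow> bool" where
  "finite_type A K \<longleftrightarrow>
     principal_minor A K \<noteq> 0 \<and>
     (\<exists>u :: 'n \<Rightarrow> real. (\<forall>i\<in>K. 0 < u i) \<and>
        (\<forall>i\<in>K. 0 < (\<Sum>j\<in>K. real_of_int (A $ i $ j) * u j))) \<and>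
     (\<forall>v :: 'n \<Rightarrow> real. (\<forall>i\<in>K. 0 \<le> (\<Sum>j\<in>K. real_of_int (A $ i $ j) * v j)) \<longrightarrow>
        (\<forall>i\<in>K. 0 < v i) \<or> (\<forall>i\<in>K. v i = 0))"

definition finite_part :: "int^'n^'n \<Rightarrow> 'n::finite set \<Rightarrow> 'n set" where
  "finite_part A K = \<Union> {L \<in> components A K. finite_type A L}"

definition pos_combs :: "('n \<Rightarrow> 'v::real_vector) \<Rightarrow> 'n set \<Rightarrow> 'v set" where
  "pos_combs a K = {(\<Sum>i\<in>K. m i *\<^sub>R a i) | m :: 'n \<Rightarrow> real. \<forall>i\<in>K. 0 < m i}"

definition mu_minus :: "('n \<Rightarrow> 'v::real_vector) \<Rightarrow> 'v \<Rightarrow> 'n set \<Rightarrow> 'v set" where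
  "mu_minus a \<mu> K = (\<lambda>x. \<mu> - x) ` pos_combs a K"

definition face ::
  "('v::real_vector \<Rightarrow> 'h \<Rightarrow> real) \<Rightarrow> ('n \<Rightarrow> 'v) \<Rightarrow> ('n \<Rightarrow> 'h) \<Rightarrow> 'v \<Rightarrow> 'n set \<Rightarrow> 'v set" where
  "face p a c \<mu> K = convex hull ((\<lambda>w. w \<mu>) ` weyl_subgroup p a c K)"

end

theory Submission
  imports Defs
begin

text \<open>
  Everything rests on the fact that \<open>\<mu> - w \<mu>\<close> is a nonnegative combination of simple roots, with
  coefficients in which the values of \<open>\<mu>\<close> on the coroots occur with natural multiplicities.  Hence only
  finitely many points of the orbit of \<open>\<mu>\<close> have bounded depth.  This finiteness passes to
  convex combinations, so every point of the face has a conjugate of least depth, which is dominant.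

  For the relative interior, a step \<open>x \<mapsto> x - \<Sum>\<^sub>i s\<^sub>i x(\<alpha>\<^sub>i\<^sup>\<or>) \<alpha>\<^sub>i\<close>
  with \<open>s\<^sub>i \<ge> 0\<close> and \<open>\<Sum>\<^sub>i s\<^sub>i \<le> 1\<close> is a convex combination of \<open>x\<close> and its
  reflections.  Such steps lead from \<open>\<mu>\<close> to every \<open>\<eta> \<in> \<mu> - \<real>\<^sub>> I\<close> which is positive on all
  coroots of \<open>I\<close>, and these \<open>\<eta>\<close> form a relatively open set.  If \<open>\<eta>\<close> vanishes on the coroots of
  \<open>J\<close>, then \<open>J\<close> is of finite type, and \<open>\<eta>\<close> is the \<open>W\<^sub>J\<close>-fixed point that belongs to a nearby
  point positive on all coroots of \<open>I\<close>; it lies in every \<open>W\<^sub>J\<close>-invariant convex set containing that point.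
\<close>

text \<open>The group generated by the reflections in \<open>I\<close> may be infinite, so the face
  may be unbounded, and neither compactness nor averaging over the group supplies minimizers and
  fixed points. Minimizers come from the discreteness of depth, fixed points from an induction over
  \<open>J\<close>.

  Signs of roots are replaced by signs of the values of \<open>w x\<close> on a coroot, for dominant
  \<open>x\<close>. Length decides these signs, and the only explicit computation is in rank two.
  Evaluation at fundamental weights then shows that integral multiplicities are natural numbers.

  Finite type enters through a positive vector \<open>u\<close> with \<open>B u > 0\<close>, which
  makes the block inverse monotone. Being \<mu>-connected has two effects: positivity of \<mu>
  reaches every index of \<open>I\<close>, and on a component of \<open>J\<close> the coefficients
  of \<mu> - \<eta> form a positive vector whose image under the block is nonnegative and not zero,
  which forces finite type.\<close>

section \<open>Alternating words and elementary estimates\<close>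

fun alternating :: "'a \<Rightarrow> 'a \<Rightarrow> nat \<Rightarrow> 'a list" where
  "alternating i j 0 = []"
| "alternating i j (Suc k) = i # alternating j i k"

lemma length_alternating [simp]: "length (alternating i j k) = k"
  by (induction k arbitrary: i j) auto

lemma set_alternating: "alternating i j k \<in> lists {i, j}"
  by (induction k arbitrary: i j) (auto simp: insert_commute)

lemma alternating_take: "m \<le> k \<Longrightarrow> \<exists>z\<in>lists {i, j}. alternating i j k = alternating i j m @ z"
proof (induction m arbitrary: i j k)
  case 0
  then show ?case using set_alternating[of i j k] by auto
next
  case (Suc m)
  then obtain k' where kk: "k = Suc k'" "m \<le> k'" by (cases k) auto
  then obtain z where "z \<in> lists {j, i}" "alternating j i k' = alternating j i m @ z"
    using Suc.IH[of k' j i] kk by blast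
  then show ?case using kk by (auto simp: insert_commute)
qed

lemma alternatingI:
  assumes "u \<in> lists {i, j}" "\<forall>x k y. u \<noteq> x @ [k, k] @ y" "u = [] \<or> hd u = i"
  shows "u = alternating i j (length u)"
  using assms
proof (induction u arbitrary: i j rule: list.induct)
  case Nil
  then show ?case by simp
next
  case (Cons k u)
  have k: "k = i" using Cons.prems by simp
  have "u = [] \<or> hd u = j"
  proof (cases u)
    case u: (Cons l u')
    then have "l \<noteq> i" using Cons.prems(2)[rule_format, of "[]" i u'] k by auto
    then show ?thesis using u Cons.prems(1) by auto
  qed simp
  moreover have "\<forall>x l y. u \<noteq> x @ [l, l] @ y"
    using Cons.prems(2) by (metis append_Cons)
  ultimately have "u = alternating j i (length u)"
    using Cons.IH[of j i] Cons.prems(1) by (auto simp: insert_commute)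
  then show ?case using k by simp
qed

lemma less_numeral_cases:
  "k < (2::nat) \<longleftrightarrow> k = 0 \<or> k = 1" "k < (3::nat) \<longleftrightarrow> k = 0 \<or> k = 1 \<or> k = 2"
  "k < (4::nat) \<longleftrightarrow> k = 0 \<or> k = 1 \<or> k = 2 \<or> k = 3"
  "k < (6::nat) \<longleftrightarrow> k = 0 \<or> k = 1 \<or> k = 2 \<or> k = 3 \<or> k = 4 \<or> k = 5"
  by linarith+

text \<open>These are the off-diagonal pairs of the finite types of rank two: A1 x A1, A2, and B2
  and G2 in both orders. Nonzero factors are at most -1, so the product bounds each absolute
  value.\<close>

lemma product_less_four:
  fixes x y :: int
  assumes "x \<le> 0" "y \<le> 0" "x * y < 4" "x = 0 \<longleftrightarrow> y = 0"
  shows "(x, y) \<in> {(0,0), (-1,-1), (-1,-2), (-2,-1), (-1,-3), (-3,-1)}"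
proof (cases "x = 0")
  case False
  then have "x \<le> -1" "y \<le> -1" using assms by auto
  then have "x * y \<ge> - x" "x * y \<ge> - y"
    using mult_left_mono_neg[of y "-1" x] mult_right_mono_neg[of x "-1" y] by auto
  then have "x \<in> {-3..-1}" "y \<in> {-3..-1}" using assms \<open>x \<le> -1\<close> \<open>y \<le> -1\<close> by auto
  moreover have "{-3..-1} = {-3,-2,-1::int}" by auto
  ultimately show ?thesis using assms(3) by auto
qed (use assms in auto)

lemma small_multiple:
  fixes f g :: "'a \<Rightarrow> real"
  assumes "finite I" "\<forall>i\<in>I. 0 < f i"
  shows "\<exists>e>0. e \<le> 1 \<and> (\<forall>i\<in>I. e * g i < f i)"
  using assms
proof (induction I rule: finite_induct)
  case empty
  show ?case by (intro exI[of _ 1]) auto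
next
  case (insert i I)
  then obtain e where e: "0 < e" "e \<le> 1" "\<forall>i\<in>I. e * g i < f i" by auto
  \<comment> \<open>The 1 in the denominator avoids division by zero and makes the new inequality
    strict.\<close>
  define d where "d = min e (f i / (1 + \<bar>g i\<bar>))"
  have fi: "0 < f i" using insert.prems by simp
  then have d: "0 < d" "d \<le> e" "d \<le> f i / (1 + \<bar>g i\<bar>)" using e by (auto simp: d_def)
  have "d * g k < f k" if k: "k \<in> I" for k
  proof (cases "g k \<le> 0")
    case True
    then have "d * g k \<le> 0" using d by (simp add: mult_nonneg_nonpos)
    then show ?thesis using insert.prems k by force
  next
    case False
    then have "d * g k \<le> e * g k" using d by (intro mult_right_mono) auto
    then show ?thesis using e k by force
  qed
  moreover have "d * g i < f i"
  proof -
    have "d * (1 + \<bar>g i\<bar>) \<le> f i" using d(3) by (simp add: pos_le_divide_eq)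
    moreover have "d * g i < d * (1 + \<bar>g i\<bar>)" using d(1) by (intro mult_strict_left_mono) auto
    ultimately show ?thesis by linarith
  qed
  ultimately show ?case using d e by (intro exI[of _ d]) auto
qed

section \<open>Reflections and words\<close>

text \<open>\<open>fundamental_weight\<close> packages duality and independence of the coroots; it
  provides test points that isolate one coroot. \<open>'v\<close> is Euclidean because relative
  interiors need its topology.\<close>

locale cartan_datum =
  fixes A :: "int^'n^'n"
    and p :: "'v::euclidean_space \<Rightarrow> 'h \<Rightarrow> real"
    and a :: "'n \<Rightarrow> 'v" and c :: "'n \<Rightarrow> 'h"
  assumes gcm: "gen_cartan_matrix A"
    and linear_p: "linear (\<lambda>\<eta>. p \<eta> h)"
    and independent_a: "independent (range a)" and inj_a: "inj a"
    and fundamental_weight: "\<exists>\<Lambda>. \<forall>j. p \<Lambda> (c j) = (if j = k then 1 else 0)"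
    and pair [simp]: "p (a j) (c i) = real_of_int (A $ i $ j)"
begin

abbreviation B :: "'n \<Rightarrow> 'n \<Rightarrow> real" where "B i j \<equiv> real_of_int (A $ i $ j)"
abbreviation r :: "'n \<Rightarrow> 'v \<Rightarrow> 'v" where "r \<equiv> reflection p a c"

lemma p_linear [simp]:
  "p (x + y) h = p x h + p y h" "p (x - y) h = p x h - p y h" "p (- x) h = - p x h"
  "p (t *\<^sub>R x) h = t * p x h" "p 0 h = 0" "p (sum f S) h = (\<Sum>i\<in>S. p (f i) h)"
  by (fact linear_add[OF linear_p] linear_diff[OF linear_p] linear_neg[OF linear_p]
      linear_scale[OF linear_p, unfolded real_scaleR_def] linear_0[OF linear_p] linear_sum[OF linear_p])+

lemma A_diag [simp]: "A $ i $ i = 2" and A_off: "i \<noteq> j \<Longrightarrow> A $ i $ j \<le> 0"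
  and A_sym0: "A $ i $ j = 0 \<Longrightarrow> A $ j $ i = 0"
  using gcm unfolding gen_cartan_matrix_def by blast+

lemma B_off: "i \<noteq> j \<Longrightarrow> B i j \<le> 0"
  using A_off by simp

lemma linear_r: "linear (r i)"
  by (rule linearI) (auto simp: reflection_def algebra_simps)

lemma r_r [simp]: "r i (r i x) = x"
  by (simp add: reflection_def algebra_simps)

lemma linear_word: "linear (foldr r w)"
proof (induction w)
  case (Cons i w)
  show ?case using linear_compose[OF Cons linear_r] by (simp add: comp_def)
qed (simp add: linear_id[unfolded id_def])

lemma word_rev [simp]: "foldr r (rev w) (foldr r w x) = x" "foldr r w (foldr r (rev w) x) = x"
proof -
  show *: "foldr r (rev w) (foldr r w x) = x" for w x by (induction w) auto
  show "foldr r w (foldr r (rev w) x) = x" using *[of "rev w" x] by simp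
qed

lemma bij_word: "bij (foldr r w)"
  by (rule bij_betw_byWitness[where f' = "foldr r (rev w)"]) auto

text \<open>Generators are involutions, so inverses add nothing to products of generators. From here
  on group elements are handled as words.\<close>

lemma weyl_subgroup_eq_words: "weyl_subgroup p a c K = foldr r ` lists K"
proof
  let ?G = "general_linear_group :: ('v \<Rightarrow> 'v) monoid"
  have bij_r: "bij (r i)" for i using bij_word[of "[i]"] by (simp add: comp_def)
  have inv_r: "inv\<^bsub>?G\<^esub> (r i) = r i" for i
    unfolding m_inv_def
  proof (rule the_equality)
    show "r i \<in> carrier ?G \<and> r i \<otimes>\<^bsub>?G\<^esub> r i = \<one>\<^bsub>?G\<^esub> \<and> r i \<otimes>\<^bsub>?G\<^esub> r i = \<one>\<^bsub>?G\<^esub>"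
      using bij_r linear_r by (auto simp: general_linear_group_def fun_eq_iff)
  next
    fix y assume "y \<in> carrier ?G \<and> r i \<otimes>\<^bsub>?G\<^esub> y = \<one>\<^bsub>?G\<^esub> \<and> y \<otimes>\<^bsub>?G\<^esub> r i = \<one>\<^bsub>?G\<^esub>"
    then have "(r i \<circ> y) z = z" for z by (simp add: general_linear_group_def)
    then show "y = r i" using r_r by (metis comp_apply ext)
  qed
  have one: "foldr r [] = \<one>\<^bsub>?G\<^esub>" by (simp add: general_linear_group_def)
  show "weyl_subgroup p a c K \<subseteq> foldr r ` lists K"
  proof
    fix f assume "f \<in> weyl_subgroup p a c K"
    then have "f \<in> generate ?G (r ` K)" by (simp add: weyl_subgroup_def)
    then show "f \<in> foldr r ` lists K"
    proof induction
      case one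
      show ?case by (rule image_eqI[where x = "[]"]) (auto simp: general_linear_group_def)
    next
      case (incl h)
      then obtain i where "i \<in> K" "h = r i" by blast
      then show ?case by (intro image_eqI[where x = "[i]"]) auto
    next
      case (inv h)
      then obtain i where "i \<in> K" "h = r i" by blast
      then show ?case by (intro image_eqI[where x = "[i]"]) (auto simp: inv_r)
    next
      case (eng h1 h2)
      then obtain w1 w2 where "w1 \<in> lists K" "w2 \<in> lists K" "h1 = foldr r w1" "h2 = foldr r w2"
        by blast
      then show ?case
        by (intro image_eqI[where x = "w1 @ w2"]) (auto simp: general_linear_group_def)
    qed
  qed
  show "foldr r ` lists K \<subseteq> weyl_subgroup p a c K"
  proof (rule image_subsetI)
    fix w assume "w \<in> lists K"
    then show "foldr r w \<in> weyl_subgroup p a c K"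
    proof induction
      case Nil
      then show ?case unfolding one weyl_subgroup_def by (rule generate.one)
    next
      case (Cons i w)
      have "foldr r (i # w) = r i \<otimes>\<^bsub>?G\<^esub> foldr r w" by (simp add: general_linear_group_def)
      moreover have "r i \<in> weyl_subgroup p a c K"
        unfolding weyl_subgroup_def using Cons.hyps by (intro generate.incl) blast
      ultimately show ?case using Cons.IH unfolding weyl_subgroup_def by (simp add: generate.eng)
    qed
  qed
qed

subsection \<open>Positivity\<close>

text \<open>On the plane through \<open>x\<close> spanned by \<open>a i\<close> and
  \<open>a j\<close> both reflections are affine in two coefficients. As rewrite rules these
  equations evaluate any word in \<open>i\<close> and \<open>j\<close> symbolically.\<close>

lemma r_coords:
  assumes "i \<noteq> j"
  shows "r i (x - s *\<^sub>R a i - t *\<^sub>R a j) = x - (p x (c i) - s - t * B i j) *\<^sub>R a i - t *\<^sub>R a j"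
    and "r j (x - s *\<^sub>R a i - t *\<^sub>R a j) = x - s *\<^sub>R a i - (p x (c j) - t - s * B j i) *\<^sub>R a j"
proof -
  have "p (x - s *\<^sub>R a i - t *\<^sub>R a j) (c i) = (p x (c i) - s - t * B i j) - s" by simp
  then show "r i (x - s *\<^sub>R a i - t *\<^sub>R a j) = x - (p x (c i) - s - t * B i j) *\<^sub>R a i - t *\<^sub>R a j"
    unfolding reflection_def by (simp only: scaleR_left_diff_distrib) simp
  have "p (x - s *\<^sub>R a i - t *\<^sub>R a j) (c j) = (p x (c j) - t - s * B j i) - t" by simp
  then show "r j (x - s *\<^sub>R a i - t *\<^sub>R a j) = x - s *\<^sub>R a i - (p x (c j) - t - s * B j i) *\<^sub>R a j"
    unfolding reflection_def by (simp only: scaleR_left_diff_distrib) simp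
qed

text \<open>The outermost reflection is \<open>r j\<close>, and the sign tells that applying
  \<open>r i\<close> next can only lower the point. This is the sign rule in rank two.\<close>

definition alternating_nonneg :: "'n \<Rightarrow> 'n \<Rightarrow> nat \<Rightarrow> bool" where
  "alternating_nonneg i j k \<longleftrightarrow>
     (\<forall>x. 0 \<le> p x (c i) \<longrightarrow> 0 \<le> p x (c j) \<longrightarrow> 0 \<le> p (foldr r (alternating j i k) x) (c i))"

lemma alternating_nonneg_infinite:
  assumes "i \<noteq> j" "4 \<le> A $ i $ j * A $ j $ i"
  shows "alternating_nonneg i j k"
proof -
  \<comment> \<open>Signs alone do not propagate. The third inequality bounds the negative value by
    half of what the next reflection adds to it, and the bound 4 lets this inequality reproduce
    itself with \<open>i\<close> and \<open>j\<close> exchanged.\<close>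
  have *: "p (foldr r (alternating j i (Suc k)) x) (c j) \<le> 0 \<and>
      0 \<le> p (foldr r (alternating j i (Suc k)) x) (c i) \<and>
      - 2 * p (foldr r (alternating j i (Suc k)) x) (c j) \<le> - B j i * p (foldr r (alternating j i (Suc k)) x) (c i)"
    if "i \<noteq> j" "4 \<le> B i j * B j i" "0 \<le> p x (c i)" "0 \<le> p x (c j)" for i j k x
    using that
  proof (induction k arbitrary: i j)
    case 0
    have "4 * p x (c j) \<le> (B i j * B j i) * p x (c j)"
      using 0 by (intro mult_right_mono) auto
    moreover have "B i j * p x (c j) \<le> 0" "B j i * p x (c i) \<le> 0" 
      using 0 B_off[of i j] B_off[of j i] by (auto simp: mult_nonpos_nonneg)
    ultimately show ?case using 0 by (simp add: reflection_def algebra_simps)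
  next
    case (Suc k)
    define y where "y = foldr r (alternating i j (Suc k)) x"
    have eq: "foldr r (alternating j i (Suc (Suc k))) x = r j y" by (simp add: y_def)
    have y: "p y (c i) \<le> 0" "0 \<le> p y (c j)" "- 2 * p y (c i) \<le> - B i j * p y (c j)"
      using Suc.IH[of j i] Suc.prems unfolding y_def by (auto simp: mult.commute)
    have b: "B i j \<le> 0" "B j i \<le> 0" using Suc.prems B_off by auto
    have n: "B j i * (- B i j * p y (c j)) \<le> B j i * (- 2 * p y (c i))"
      using y(3) b(2) by (rule mult_left_mono_neg)
    have "4 * p y (c j) \<le> (B i j * B j i) * p y (c j)"
      using Suc.prems y by (intro mult_right_mono) auto
    moreover have "B i j * p y (c j) \<le> 0" using b y by (simp add: mult_nonpos_nonneg)
    ultimately show ?case using y n unfolding eq by (simp add: reflection_def algebra_simps)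
  qed
  have 4: "4 \<le> B i j * B j i"
    using assms(2) by (metis of_int_le_iff of_int_mult of_int_numeral)
  show ?thesis
  proof (cases k)
    case 0
    then show ?thesis by (simp add: alternating_nonneg_def)
  next
    case (Suc k')
    then show ?thesis using *[OF assms(1) 4] by (auto simp: alternating_nonneg_def simp del: alternating.simps)
  qed
qed

text \<open>The alternatives reflect infinite and finite dihedral groups. In the finite case
  \<open>m\<close> is the order of the product of the two reflections: 2, 3, 4 or 6 as the product
  of the off-diagonal entries is 0, 1, 2 or 3.\<close>

lemma rank_two_dichotomy:
  assumes "i \<noteq> j"
  shows "(\<forall>k. alternating_nonneg i j k) \<or>
    (\<exists>m>0. (\<forall>k<m. alternating_nonneg i j k) \<and>
         foldr r (alternating i j m) = foldr r (alternating j i m))"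
proof (cases "4 \<le> A $ i $ j * A $ j $ i")
  case True
  then show ?thesis using alternating_nonneg_infinite[OF assms] by auto
next
  case False
  note word_coords = eval_nat_numeral BitM.simps numeral_One One_nat_def alternating.simps foldr_Cons foldr_Nil
    comp_apply id_apply r_coords[OF assms]
  note nonneg = eval_nat_numeral alternating_nonneg_def reflection_def algebra_simps
  \<comment> \<open>The zero multiples bring the point into the shape on which
    \<open>r_coords\<close> rewrites.\<close>
  have words_eqI: "foldr r u = foldr r v"
    if "\<And>x. foldr r u (x - 0 *\<^sub>R a i - 0 *\<^sub>R a j) = foldr r v (x - 0 *\<^sub>R a i - 0 *\<^sub>R a j)" for u v
    using that by (simp add: fun_eq_iff)
  have "(A $ i $ j, A $ j $ i) \<in> {(0,0), (-1,-1), (-1,-2), (-2,-1), (-1,-3), (-3,-1)}"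
    using False A_off[OF assms] A_off[OF assms[symmetric]] A_sym0[of i j] A_sym0[of j i]
    by (intro product_less_four) auto
  then consider "A $ i $ j = 0" "A $ j $ i = 0" | "A $ i $ j = -1" "A $ j $ i = -1"
    | "A $ i $ j = -1" "A $ j $ i = -2" | "A $ i $ j = -2" "A $ j $ i = -1"
    | "A $ i $ j = -1" "A $ j $ i = -3" | "A $ i $ j = -3" "A $ j $ i = -1" by auto
  then have "\<exists>m>0. (\<forall>k<m. alternating_nonneg i j k) \<and>
         foldr r (alternating i j m) = foldr r (alternating j i m)"
  proof cases
    case 1
    have "foldr r (alternating i j 2) = foldr r (alternating j i 2)"
      by (rule words_eqI) (simp only: word_coords 1, simp add: algebra_simps)
    moreover have "\<forall>k<2. alternating_nonneg i j k"
      unfolding less_numeral_cases using 1 by (auto simp: nonneg)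
    ultimately show ?thesis by (meson zero_less_numeral)
  next
    case 2
    have "foldr r (alternating i j 3) = foldr r (alternating j i 3)"
      by (rule words_eqI) (simp only: word_coords 2, simp add: algebra_simps)
    moreover have "\<forall>k<3. alternating_nonneg i j k"
      unfolding less_numeral_cases using 2 by (auto simp: nonneg)
    ultimately show ?thesis by (meson zero_less_numeral)
  next
    case 3
    have "foldr r (alternating i j 4) = foldr r (alternating j i 4)"
      by (rule words_eqI) (simp only: word_coords 3, simp add: algebra_simps)
    moreover have "\<forall>k<4. alternating_nonneg i j k"
      unfolding less_numeral_cases using 3 by (auto simp: nonneg)
    ultimately show ?thesis by (meson zero_less_numeral)
  next
    case 4
    have "foldr r (alternating i j 4) = foldr r (alternating j i 4)"
      by (rule words_eqI) (simp only: word_coords 4, simp add: algebra_simps)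
    moreover have "\<forall>k<4. alternating_nonneg i j k"
      unfolding less_numeral_cases using 4 by (auto simp: nonneg)
    ultimately show ?thesis by (meson zero_less_numeral)
  next
    case 5
    have "foldr r (alternating i j 6) = foldr r (alternating j i 6)"
      by (rule words_eqI) (simp only: word_coords 5, simp add: algebra_simps)
    moreover have "\<forall>k<6. alternating_nonneg i j k"
      unfolding less_numeral_cases using 5 by (auto simp: nonneg)
    ultimately show ?thesis by (meson zero_less_numeral)
  next
    case 6
    have "foldr r (alternating i j 6) = foldr r (alternating j i 6)"
      by (rule words_eqI) (simp only: word_coords 6, simp add: algebra_simps)
    moreover have "\<forall>k<6. alternating_nonneg i j k"
      unfolding less_numeral_cases using 6 by (auto simp: nonneg)
    ultimately show ?thesis by (meson zero_less_numeral)
  qed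
  then show ?thesis by blast
qed


text \<open>Minimality excludes repeated letters and \<open>min_iu\<close> excludes the first letter
  \<open>i\<close>, so \<open>u\<close> alternates and starts with \<open>j\<close>. If its length
  reached \<open>m\<close>, the braid relation would let it start with \<open>i\<close>; then
  \<open>r i\<close> would cancel that letter, against \<open>min_iu\<close>.\<close>

lemma dihedral_nonneg:
  assumes ij: "i \<noteq> j" and u: "u \<in> lists {i, j}"
    and min_u: "\<And>u'. u' \<in> lists {i, j} \<Longrightarrow> foldr r u' = foldr r u \<Longrightarrow> length u \<le> length u'"
    and min_iu: "\<And>u'. u' \<in> lists {i, j} \<Longrightarrow> foldr r u' = foldr r (i # u) \<Longrightarrow> length u \<le> length u'"
    and x: "0 \<le> p x (c i)" "0 \<le> p x (c j)"
  shows "0 \<le> p (foldr r u x) (c i)"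
proof -
  have "\<forall>y k z. u \<noteq> y @ [k, k] @ z"
  proof (intro allI notI)
    fix y k z assume eq: "u = y @ [k, k] @ z"
    then have "foldr r (y @ z) = foldr r u" by (simp add: fun_eq_iff)
    then show False using min_u[of "y @ z"] u eq by auto
  qed
  moreover have "u = [] \<or> hd u = j"
  proof (cases u)
    case (Cons k u')
    have "k \<noteq> i"
    proof
      assume "k = i"
      then have "foldr r u' = foldr r (i # u)" using Cons by (simp add: fun_eq_iff)
      then show False using min_iu[of u'] u Cons by auto
    qed
    then show ?thesis using u Cons by auto
  qed simp
  ultimately have alt: "u = alternating j i (length u)"
    using u by (intro alternatingI) (auto simp: insert_commute)
  have goal: ?thesis if "alternating_nonneg i j (length u)"
    using that x alt unfolding alternating_nonneg_def by metis
  from rank_two_dichotomy[OF ij] show ?thesis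
  proof
    assume "\<forall>k. alternating_nonneg i j k"
    then show ?thesis using goal by blast
  next
    assume "\<exists>m>0. (\<forall>k<m. alternating_nonneg i j k) \<and>
         foldr r (alternating i j m) = foldr r (alternating j i m)"
    then obtain m where m: "0 < m" "\<forall>k<m. alternating_nonneg i j k"
      and braid: "foldr r (alternating i j m) = foldr r (alternating j i m)" by blast
    show ?thesis
    proof (cases "length u < m")
      case True
      then show ?thesis using goal m by blast
    next
      case False
      then obtain z where z: "z \<in> lists {j, i}" "u = alternating j i m @ z"
        using alternating_take[of m "length u" j i] alt by auto
      obtain m' where m': "m = Suc m'" using m(1) by (cases m) auto
      have "foldr r (alternating j i m' @ z) y = foldr r (i # u) y" for y
      proof -
        have "foldr r u y = foldr r (alternating i j m) (foldr r z y)" using z braid by simp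
        then show ?thesis using m' by simp
      qed
      then have "length u \<le> length (alternating j i m' @ z)"
        using z set_alternating[of j i m'] by (intro min_iu) (auto simp: insert_commute)
      then show ?thesis using z m' by simp
    qed
  qed
qed

text \<open>The length in the subgroup generated by \<open>K\<close>. It depends on \<open>w\<close>
  only through \<open>foldr r w\<close>, so a word may be exchanged for a reduced one.\<close>

definition len :: "'n set \<Rightarrow> 'n list \<Rightarrow> nat" where
  "len K w = (LEAST n. \<exists>w'\<in>lists K. length w' = n \<and> foldr r w' = foldr r w)"

lemma len_le: "w' \<in> lists K \<Longrightarrow> foldr r w' = foldr r w \<Longrightarrow> len K w \<le> length w'"
  unfolding len_def by (rule Least_le) blast

lemma len_attained:
  assumes "w \<in> lists K"
  obtains w' where "w' \<in> lists K" "length w' = len K w" "foldr r w' = foldr r w"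
proof -
  have "\<exists>w'\<in>lists K. length w' = len K w \<and> foldr r w' = foldr r w"
    unfolding len_def by (rule LeastI_ex) (use assms in blast)
  then show ?thesis using that by blast
qed

text \<open>
  The standard argument for the sign of real roots: write \<open>w = u v\<close> with \<open>u\<close> in the dihedral
  subgroup of \<open>i, j\<close> and \<open>v\<close> as short as possible.
\<close>

lemma nonneg_of_len:
  assumes "w \<in> lists K" "i \<in> K" "len K w \<le> len K (i # w)" and x: "\<forall>j\<in>K. 0 \<le> p x (c j)"
  shows "0 \<le> p (foldr r w x) (c i)"
  using assms(1-3)
proof (induction "len K w" arbitrary: w i rule: less_induct)
  case less
  obtain w0 where w0: "w0 \<in> lists K" "length w0 = len K w" "foldr r w0 = foldr r w"
    using len_attained less.prems(1) by blast
  show ?case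
  proof (cases w0)
    case Nil
    then have "foldr r w x = x" using w0(3) by (metis foldr_Nil id_apply)
    then show ?thesis using x less.prems by simp
  next
    case (Cons j w')
    have j: "j \<in> K" "w' \<in> lists K" "Suc (length w') = len K w" using w0 Cons by auto
    have w: "foldr r w y = r j (foldr r w' y)" for y using w0(3) Cons by (metis comp_apply foldr_Cons)
    have "j \<noteq> i"
    proof
      assume "j = i"
      then have "foldr r w' = foldr r (i # w)" using w by (auto simp: fun_eq_iff)
      then show False using len_le[of w' K "i # w"] j less.prems by simp
    qed
    \<comment> \<open>Factorizations whose lengths add up to \<open>len K w\<close>. Splitting off
      the first letter \<open>j\<close> of a reduced word gives one with \<open>v\<close> shorter
      than \<open>w\<close>, so the induction hypothesis will apply to the shortest
      \<open>v\<close>.\<close>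
    define Q where "Q k \<longleftrightarrow> (\<exists>u\<in>lists {i, j}. \<exists>v\<in>lists K. foldr r w = foldr r (u @ v) \<and>
      length u + length v = len K w \<and> length v = k)" for k
    have "Q (length w')"
      unfolding Q_def
      using j w by (intro bexI[of _ "[j]"] bexI[of _ w']) (auto simp: fun_eq_iff)
    define k where "k = (LEAST k. Q k)"
    have "Q k" unfolding k_def using \<open>Q (length w')\<close> by (rule LeastI[of Q])
    have kmin: "k \<le> k'" if "Q k'" for k' unfolding k_def using that by (rule Least_le[of Q])
    have k: "k < len K w" using kmin[OF \<open>Q (length w')\<close>] j(3) by simp
    obtain u v where uv: "u \<in> lists {i, j}" "v \<in> lists K" "foldr r w = foldr r (u @ v)"
      "length u + length v = len K w" "length v = k"
      using \<open>Q k\<close> unfolding Q_def by blast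
    have uvK: "u \<in> lists K" using uv(1) j(1) less.prems(2) by auto
    have lv: "len K v = k"
    proof (rule antisym)
      show "len K v \<le> k" using len_le[of v K v] uv by simp
      obtain v' where v': "v' \<in> lists K" "length v' = len K v" "foldr r v' = foldr r v"
        using len_attained uv(2) by blast
      have "len K w \<le> length (u @ v')" using uvK v' uv(3) by (intro len_le) auto
      then show "k \<le> len K v" using uv v' by simp
    qed
    \<comment> \<open>If prepending \<open>l\<close> shortened \<open>v\<close>, then
      \<open>l\<close> could be moved into the dihedral factor, leaving a shorter
      \<open>v\<close>.\<close>
    have grow: "len K v \<le> len K (l # v)" if l: "l \<in> {i, j}" for l
    proof (rule ccontr)
      assume "\<not> len K v \<le> len K (l # v)"
      moreover obtain v' where v': "v' \<in> lists K" "length v' = len K (l # v)"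
        "foldr r v' = foldr r (l # v)"
        using len_attained[of "l # v" K] uv(2) l j(1) less.prems(2) by auto
      ultimately have less_k: "length v' < k" using lv by simp
      have "foldr r v' y = r l (foldr r v y)" for y using v'(3) by simp
      then have eq: "foldr r w = foldr r ((u @ [l]) @ v')" using uv(3) by (simp add: fun_eq_iff)
      have "len K w \<le> length ((u @ [l]) @ v')"
        using uvK v' l j(1) less.prems(2) eq by (intro len_le) auto
      then have "Q (length v')"
        unfolding Q_def using eq v'(1) uv less_k l
        by (intro bexI[of _ "u @ [l]"] bexI[of _ v']) auto
      then show False using kmin less_k by fastforce
    qed
    have nn: "0 \<le> p (foldr r v x) (c l)" if l: "l \<in> {i, j}" for l
      using less.hyps[of v l] lv k uv(2) l j(1) less.prems(2) grow by auto
    have "0 \<le> p (foldr r u (foldr r v x)) (c i)"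
    proof (rule dihedral_nonneg[OF \<open>j \<noteq> i\<close>[symmetric] uv(1)])
      fix u' assume u': "u' \<in> lists {i, j}" "foldr r u' = foldr r u"
      then have "len K w \<le> length (u' @ v)"
        using uv(2,3) j(1) less.prems(2) by (intro len_le) auto
      then show "length u \<le> length u'" using uv(4) by simp
    next
      fix u' assume u': "u' \<in> lists {i, j}" "foldr r u' = foldr r (i # u)"
      have "foldr r (u' @ v) = foldr r (i # w)" using u'(2) uv(3) by (simp add: fun_eq_iff)
      then have "len K (i # w) \<le> length (u' @ v)"
        using u'(1) uv(2) j(1) less.prems(2) by (intro len_le) auto
      then show "length u \<le> length u'" using uv(4) less.prems(3) by simp
    qed (use nn in auto)
    then show ?thesis using uv(3) by simp
  qed
qed

section \<open>Coordinates along simple roots, and the sign of the coefficients\<close>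

text \<open>The simple roots need not span \<open>'v\<close>; a choice of extension makes the
  coordinates total linear functionals.\<close>

definition coord :: "'n \<Rightarrow> 'v \<Rightarrow> real" where
  "coord i = (SOME f. linear f \<and> (\<forall>j. f (a j) = (if j = i then 1 else 0)))"

lemma coord: "linear (coord i)" "coord i (a j) = (if j = i then 1 else 0)"
proof -
  obtain f where f: "linear f" "\<forall>v\<in>range a. f v = (if v = a i then 1 else 0 :: real)"
    using linear_independent_extend[OF independent_a, of "\<lambda>v. if v = a i then 1 else 0"] by blast
  then have "\<exists>f. linear f \<and> (\<forall>j. f (a j) = (if j = i then 1 else 0 :: real))"
    using inj_a by (intro exI[of _ f]) (auto simp: inj_def)
  then have "linear (coord i) \<and> (\<forall>j. coord i (a j) = (if j = i then 1 else 0))"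
    unfolding coord_def by (rule someI_ex)
  then show "linear (coord i)" "coord i (a j) = (if j = i then 1 else 0)" by auto
qed

lemma coord_linear [simp]:
  "coord i (x + y) = coord i x + coord i y" "coord i (x - y) = coord i x - coord i y"
  "coord i (- x) = - coord i x" "coord i (t *\<^sub>R x) = t * coord i x" "coord i 0 = 0"
  "coord i (sum f S) = (\<Sum>k\<in>S. coord i (f k))"
  by (fact linear_add[OF coord(1)] linear_diff[OF coord(1)] linear_neg[OF coord(1)]
      linear_scale[OF coord(1), unfolded real_scaleR_def] linear_0[OF coord(1)]
      linear_sum[OF coord(1)])+

declare coord(2) [simp]

lemma coord_sum: "finite K \<Longrightarrow> coord i (\<Sum>k\<in>K. m k *\<^sub>R a k) = (if i \<in> K then m i else 0)"
  by (simp add: if_distrib[of "(*) _"] cong: if_cong)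

lemma span_coord:
  assumes "x \<in> span (a ` K)"
  shows "x = (\<Sum>i\<in>K. coord i x *\<^sub>R a i)"
proof -
  have "finite (a ` K)" by simp
  then obtain m where "x = (\<Sum>v\<in>a ` K. m v *\<^sub>R v)" using assms span_finite by blast
  also have "\<dots> = (\<Sum>i\<in>K. m (a i) *\<^sub>R a i)"
    using inj_a by (subst sum.reindex) (auto simp: inj_on_def inj_def)
  finally have x: "x = (\<Sum>i\<in>K. m (a i) *\<^sub>R a i)" .
  have "coord i x = m (a i)" if "i \<in> K" for i
    using that by (subst x) (simp only: coord_sum finite if_True)
  then show ?thesis by (subst x) (rule sum.cong, auto)
qed

lemma sum_in_span: "(\<Sum>i\<in>K. m i *\<^sub>R a i) \<in> span (a ` K)"
  by (intro span_sum span_scale span_base) auto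

lemma coord_outside:
  assumes "x \<in> span (a ` K)" "i \<notin> K"
  shows "coord i x = 0"
  by (subst span_coord[OF assms(1)]) (simp only: coord_sum finite assms(2) if_False)

definition nonneg_cone :: "'n set \<Rightarrow> 'v set" where
  "nonneg_cone K = {x \<in> span (a ` K). \<forall>i\<in>K. 0 \<le> coord i x}"

lemma nonneg_cone_coord: "x \<in> nonneg_cone K \<Longrightarrow> 0 \<le> coord i x"
  using coord_outside[of x K i] by (cases "i \<in> K") (auto simp: nonneg_cone_def)

text \<open>Suffixes of a reduced word are reduced, so by \<open>nonneg_of_len\<close> each further
  reflection subtracts a nonnegative multiple of a simple root. Other words are replaced by reduced
  ones.\<close>

lemma word_in_cone:
  assumes "w \<in> lists K" and x: "\<forall>j\<in>K. 0 \<le> p x (c j)"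
  shows "x - foldr r w x \<in> nonneg_cone K"
proof -
  have *: "x - foldr r w x \<in> nonneg_cone K" if "w \<in> lists K" "length w \<le> len K w" for w
    using that
  proof (induction w)
    case Nil
    then show ?case by (simp add: nonneg_cone_def span_zero)
  next
    case (Cons i w)
    then have iw: "i \<in> K" "w \<in> lists K" by auto
    obtain w' where w': "w' \<in> lists K" "length w' = len K w" "foldr r w' = foldr r w"
      using len_attained iw by blast
    have "len K (i # w) \<le> length (i # w')" using w' iw by (intro len_le) (auto simp: fun_eq_iff)
    then have red: "length w \<le> len K w" using Cons.prems w' by simp
    then have "len K w = length w" using len_le[of w K w] iw by simp
    then have nn: "0 \<le> p (foldr r w x) (c i)"
      using nonneg_of_len[OF iw(2,1) _ x] Cons.prems by simp
    have "x - foldr r (i # w) x = (x - foldr r w x) + p (foldr r w x) (c i) *\<^sub>R a i"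
      by (simp add: reflection_def)
    moreover have "x - foldr r w x \<in> nonneg_cone K" using Cons.IH iw red by blast
    ultimately show ?case using nn iw(1) unfolding nonneg_cone_def mem_Collect_eq
      by (simp only:) (auto intro!: span_add[OF _ span_scale[OF span_base]])
  qed
  obtain w' where w': "w' \<in> lists K" "length w' = len K w" "foldr r w' = foldr r w"
    using len_attained assms by blast
  have "len K w' = len K w" using w'(3) unfolding len_def by simp
  then show ?thesis using *[of w'] w' by simp
qed

text \<open>The integers depend on the word and not on \<open>x\<close>, so they can later be tested
  at points of choice.\<close>

lemma word_integral:
  assumes "w \<in> lists K"
  shows "\<exists>n :: 'n \<Rightarrow> 'n \<Rightarrow> int. \<forall>x. foldr r w x =
    x - (\<Sum>k\<in>K. (\<Sum>j\<in>K. of_int (n k j) * p x (c j)) *\<^sub>R a k)"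
  using assms
proof (induction w rule: list.induct)
  case Nil
  show ?case by (intro exI[of _ "\<lambda>_ _. 0"]) simp
next
  case (Cons i w)
  then have i: "i \<in> K" by simp
  obtain n :: "'n \<Rightarrow> 'n \<Rightarrow> int"
    where n: "\<And>x. foldr r w x = x - (\<Sum>k\<in>K. (\<Sum>j\<in>K. of_int (n k j) * p x (c j)) *\<^sub>R a k)"
    using Cons by auto
  \<comment> \<open>These integers express \<open>p (foldr r w x) (c i)\<close> through the values
    of \<open>x\<close> on the coroots.\<close>
  define d where "d j = (if j = i then 1 else 0) - (\<Sum>k\<in>K. A $ i $ k * n k j)" for j
  define n' where "n' k j = n k j + (if k = i then d j else 0)" for k j
  have "foldr r (i # w) x = x - (\<Sum>k\<in>K. (\<Sum>j\<in>K. of_int (n' k j) * p x (c j)) *\<^sub>R a k)" for x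
  proof -
    define s where "s k = (\<Sum>j\<in>K. of_int (n k j) * p x (c j))" for k
    have w: "foldr r w x = x - (\<Sum>k\<in>K. s k *\<^sub>R a k)" using n s_def by simp
    have "(\<Sum>j\<in>K. of_int (d j) * p x (c j)) =
        (\<Sum>j\<in>K. if j = i then p x (c j) else 0) - (\<Sum>j\<in>K. \<Sum>k\<in>K. B i k * n k j * p x (c j))"
      unfolding sum_subtractf[symmetric]
      by (rule sum.cong) (auto simp: d_def algebra_simps sum_distrib_left)
    also have "\<dots> = p x (c i) - (\<Sum>k\<in>K. \<Sum>j\<in>K. B i k * n k j * p x (c j))"
      using i by (subst sum.swap) simp
    also have "\<dots> = p (foldr r w x) (c i)"
      unfolding w s_def by (simp add: sum_distrib_left sum_distrib_right mult_ac)
    finally have d: "(\<Sum>j\<in>K. of_int (d j) * p x (c j)) = p (foldr r w x) (c i)" .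
    have "(\<Sum>j\<in>K. of_int (n' k j) * p x (c j)) = s k + (if k = i then p (foldr r w x) (c i) else 0)" for k
      unfolding n'_def s_def d[symmetric] by (simp add: algebra_simps sum.distrib)
    then have "(\<Sum>k\<in>K. (\<Sum>j\<in>K. of_int (n' k j) * p x (c j)) *\<^sub>R a k) =
        (\<Sum>k\<in>K. s k *\<^sub>R a k + (if k = i then p (foldr r w x) (c i) *\<^sub>R a k else 0))"
      by (intro sum.cong) (auto simp: algebra_simps)
    also have "\<dots> = (\<Sum>k\<in>K. s k *\<^sub>R a k) + p (foldr r w x) (c i) *\<^sub>R a i"
      using i by (simp add: sum.distrib)
    finally show ?thesis using w by (simp add: reflection_def)
  qed
  then show ?case by blast
qed

lemma word_natural:
  assumes "w \<in> lists K"
  obtains n :: "'n \<Rightarrow> 'n \<Rightarrow> nat" where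
    "\<And>x. foldr r w x = x - (\<Sum>k\<in>K. (\<Sum>j\<in>K. real (n k j) * p x (c j)) *\<^sub>R a k)"
proof -
  obtain n :: "'n \<Rightarrow> 'n \<Rightarrow> int"
    where n: "\<And>x. foldr r w x = x - (\<Sum>k\<in>K. (\<Sum>j\<in>K. of_int (n k j) * p x (c j)) *\<^sub>R a k)"
    using word_integral[OF assms] by blast
  have nn: "0 \<le> n k j" if "k \<in> K" "j \<in> K" for k j
  proof -
    \<comment> \<open>At the fundamental weight of \<open>j\<close> the inner sum collapses to the
      single entry \<open>n k j\<close>, whose sign is known from the cone.\<close>
    obtain \<Lambda> where L: "\<And>l. p \<Lambda> (c l) = (if l = j then 1 else 0)" using fundamental_weight by metis
    have "\<Lambda> - foldr r w \<Lambda> \<in> nonneg_cone K" using assms by (rule word_in_cone) (simp add: L)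
    then have "0 \<le> coord k (\<Lambda> - foldr r w \<Lambda>)" by (rule nonneg_cone_coord)
    also have "\<Lambda> - foldr r w \<Lambda> = (\<Sum>k\<in>K. (\<Sum>j\<in>K. of_int (n k j) * p \<Lambda> (c j)) *\<^sub>R a k)"
      by (subst n) simp
    also have "coord k \<dots> = (\<Sum>l\<in>K. of_int (n k l) * p \<Lambda> (c l))"
      using that by (simp only: coord_sum finite if_True)
    also have "\<dots> = of_int (n k j)" using that by (simp add: L if_distrib cong: if_cong)
    finally show ?thesis by simp
  qed
  have "foldr r w x = x - (\<Sum>k\<in>K. (\<Sum>j\<in>K. real (nat (n k j)) * p x (c j)) *\<^sub>R a k)" for x
    by (subst n, intro arg_cong2[where f = "(-)"] refl sum.cong arg_cong2[where f = scaleR])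
      (use nn in simp)
  then show ?thesis by (rule that)
qed

section \<open>Orbits, depth and dominant conjugates\<close>

definition ht :: "'v \<Rightarrow> real" where "ht x = (\<Sum>k\<in>UNIV. coord k x)"

lemma ht_linear [simp]:
  "ht (x + y) = ht x + ht y" "ht (x - y) = ht x - ht y" "ht (t *\<^sub>R x) = t * ht x"
  "ht 0 = 0" "ht (a i) = 1"
  by (simp_all add: ht_def sum.distrib sum_subtractf sum_distrib_left)

definition orbit :: "'n set \<Rightarrow> 'v \<Rightarrow> 'v set" where
  "orbit K x = (\<lambda>w. foldr r w x) ` lists K"

lemma orbit_self: "x \<in> orbit K x"
  unfolding orbit_def by (rule image_eqI[where x = "[]"]) auto

lemma orbit_r: "y \<in> orbit K x \<Longrightarrow> i \<in> K \<Longrightarrow> r i y \<in> orbit K x"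
proof -
  assume "y \<in> orbit K x" "i \<in> K"
  then obtain w where "w \<in> lists K" "y = foldr r w x" by (auto simp: orbit_def)
  then show ?thesis unfolding orbit_def using \<open>i \<in> K\<close> by (intro image_eqI[where x = "i # w"]) auto
qed

text \<open>Bounded depth bounds every multiplicity of a positive value of \<open>x\<close>.
  Multiplicities of zero values may be large but do not affect the point, hence the restriction to
  \<open>J\<close>.\<close>

lemma finite_orbit_bounded:
  assumes x: "\<forall>j\<in>K. 0 \<le> p x (c j)"
  shows "finite {y \<in> orbit K x. ht (x - y) \<le> M}"
proof -
  define J where "J = {j \<in> K. p x (c j) > 0}"
  define F where "F = (\<lambda>g. x - (\<Sum>k\<in>K. (\<Sum>j\<in>J. real (g (k, j)) * p x (c j)) *\<^sub>R a k)) `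
    (PiE (K \<times> J) (\<lambda>(k, j). {..nat \<lceil>M / p x (c j)\<rceil>}))"
  have "{y \<in> orbit K x. ht (x - y) \<le> M} \<subseteq> F"
  proof clarify
    fix y assume "y \<in> orbit K x" and M: "ht (x - y) \<le> M"
    then obtain w where w: "w \<in> lists K" "y = foldr r w x" by (auto simp: orbit_def)
    obtain n :: "'n \<Rightarrow> 'n \<Rightarrow> nat"
      where n: "\<And>x. foldr r w x = x - (\<Sum>k\<in>K. (\<Sum>j\<in>K. real (n k j) * p x (c j)) *\<^sub>R a k)"
      using word_natural[OF w(1)] by blast
    have J: "(\<Sum>j\<in>K. real (n k j) * p x (c j)) = (\<Sum>j\<in>J. real (n k j) * p x (c j))" for k
    proof (rule sum.mono_neutral_right)
    show "\<forall>j\<in>K - J. real (n k j) * p x (c j) = 0"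
      using x unfolding J_def by (metis (mono_tags, lifting) DiffD1 DiffD2 antisym_conv2 mem_Collect_eq mult_zero_right)
  qed (auto simp: J_def)
    have y: "x - y = (\<Sum>k\<in>K. (\<Sum>j\<in>J. real (n k j) * p x (c j)) *\<^sub>R a k)"
      unfolding w n J by simp
    have le: "n k j \<le> nat \<lceil>M / p x (c j)\<rceil>" if kj: "k \<in> K" "j \<in> J" for k j
    proof -
      have pos: "p x (c j) > 0" using kj J_def by simp
      have nn: "0 \<le> real (n k j) * p x (c j)" if "j \<in> J" for k j using that J_def by simp
      have "real (n k j) * p x (c j) \<le> (\<Sum>j\<in>J. real (n k j) * p x (c j))"
        using kj nn by (intro member_le_sum) auto
      also have "\<dots> = coord k (x - y)" unfolding y using kj by (simp only: coord_sum finite if_True)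
      also have "\<dots> \<le> ht (x - y)"
        unfolding ht_def using nonneg_cone_coord[OF word_in_cone[OF w(1) x]] w(2)
        by (intro member_le_sum) auto
      finally have "real (n k j) \<le> M / p x (c j)" using M pos by (simp add: field_simps)
      then show ?thesis by linarith
    qed
    have "y = x - (\<Sum>k\<in>K. (\<Sum>j\<in>J. real (restrict (\<lambda>(k, j). n k j) (K \<times> J) (k, j)) * p x (c j)) *\<^sub>R a k)"
    proof -
      have "(\<Sum>k\<in>K. (\<Sum>j\<in>J. real (restrict (\<lambda>(k, j). n k j) (K \<times> J) (k, j)) * p x (c j)) *\<^sub>R a k) = x - y"
        unfolding y by (intro sum.cong arg_cong2[where f = scaleR] refl) auto
      then show ?thesis by simp
    qed
    moreover have "restrict (\<lambda>(k, j). n k j) (K \<times> J) \<in> PiE (K \<times> J) (\<lambda>(k, j). {..nat \<lceil>M / p x (c j)\<rceil>})"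
      using le by auto
    ultimately show "y \<in> F" unfolding F_def by blast
  qed
  moreover have "finite F" unfolding F_def by (intro finite_imageI finite_PiE) auto
  ultimately show ?thesis by (rule finite_subset)
qed

lemma linear_word_simps:
  "foldr r w (x + y) = foldr r w x + foldr r w y" "foldr r w (x - y) = foldr r w x - foldr r w y"
  "foldr r w (t *\<^sub>R x) = t *\<^sub>R foldr r w x"
  by (fact linear_add[OF linear_word] linear_diff[OF linear_word] linear_scale[OF linear_word])+

lemma nonneg_cone_comb:
  "x \<in> nonneg_cone K \<Longrightarrow> y \<in> nonneg_cone K \<Longrightarrow> 0 \<le> s \<Longrightarrow> 0 \<le> t \<Longrightarrow>
    s *\<^sub>R x + t *\<^sub>R y \<in> nonneg_cone K"
  by (auto simp: nonneg_cone_def span_add span_scale)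

definition tame :: "'n set \<Rightarrow> 'v \<Rightarrow> 'v set" where
  "tame K x = {y. (\<forall>z\<in>orbit K y. x - z \<in> nonneg_cone K) \<and>
     (\<forall>M. finite {z \<in> orbit K y. ht (x - z) \<le> M})}"

text \<open>Words act linearly, so orbit points of a combination are combinations of orbit points
  with the same weights. Both depths are nonnegative, so depth at most \<open>M\<close> forces
  depths at most \<open>M / u\<close> and \<open>M / v\<close>; zero weights are split off because
  of the division.\<close>

lemma convex_tame: "convex (tame K x)"
proof (rule convexI)
  fix y z and u v :: real
  assume y: "y \<in> tame K x" and z: "z \<in> tame K x" and uv: "0 \<le> u" "0 \<le> v" "u + v = 1"
  have x: "x - (u *\<^sub>R y' + v *\<^sub>R z') = u *\<^sub>R (x - y') + v *\<^sub>R (x - z')" for y' z'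
  proof -
    have "u *\<^sub>R (x - y') + v *\<^sub>R (x - z') = (u + v) *\<^sub>R x - (u *\<^sub>R y' + v *\<^sub>R z')"
      by (simp add: algebra_simps)
    then show ?thesis using uv(3) by simp
  qed
  have orb: "\<exists>y'\<in>orbit K y. \<exists>z'\<in>orbit K z. q = u *\<^sub>R y' + v *\<^sub>R z'"
    if "q \<in> orbit K (u *\<^sub>R y + v *\<^sub>R z)" for q
    using that by (auto simp: orbit_def linear_word_simps)
  consider "u = 0" "v = 1" | "v = 0" "u = 1" | "0 < u" "0 < v" using uv by linarith
  then show "u *\<^sub>R y + v *\<^sub>R z \<in> tame K x"
  proof cases
    case 3
    have cone: "x - y' \<in> nonneg_cone K" "x - z' \<in> nonneg_cone K"
      if "y' \<in> orbit K y" "z' \<in> orbit K z" for y' z'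
      using y z that by (auto simp: tame_def)
    have ht_nonneg: "0 \<le> ht q" if "q \<in> nonneg_cone K" for q
      unfolding ht_def using that by (intro sum_nonneg nonneg_cone_coord)
    have "{q \<in> orbit K (u *\<^sub>R y + v *\<^sub>R z). ht (x - q) \<le> M} \<subseteq>
      (\<lambda>(y', z'). u *\<^sub>R y' + v *\<^sub>R z') ` ({y' \<in> orbit K y. ht (x - y') \<le> M / u} \<times>
         {z' \<in> orbit K z. ht (x - z') \<le> M / v})" for M
    proof clarify
      fix q assume q: "q \<in> orbit K (u *\<^sub>R y + v *\<^sub>R z)" and M: "ht (x - q) \<le> M"
      obtain y' z' where y'z': "y' \<in> orbit K y" "z' \<in> orbit K z" "q = u *\<^sub>R y' + v *\<^sub>R z'"
        using orb[OF q] by blast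
      have sum: "u * ht (x - y') + v * ht (x - z') \<le> M"
        using M unfolding y'z'(3) x by (simp only: ht_linear)
      have "0 \<le> u * ht (x - y')" "0 \<le> v * ht (x - z')"
        using ht_nonneg cone[OF y'z'(1,2)] uv by (auto intro!: mult_nonneg_nonneg simp del: ht_linear)
      then have "ht (x - y') * u \<le> M" "ht (x - z') * v \<le> M" using sum by (auto simp: mult.commute)
      then have "ht (x - y') \<le> M / u" "ht (x - z') \<le> M / v" using 3 by (auto simp: pos_le_divide_eq)
      then show "q \<in> (\<lambda>(y', z'). u *\<^sub>R y' + v *\<^sub>R z') ` ({y' \<in> orbit K y. ht (x - y') \<le> M / u} \<times>
         {z' \<in> orbit K z. ht (x - z') \<le> M / v})"
        using y'z' by (intro image_eqI[where x = "(y', z')"]) auto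
    qed
    moreover have "finite ({y' \<in> orbit K y. ht (x - y') \<le> M / u} \<times>
         {z' \<in> orbit K z. ht (x - z') \<le> M / v})" for M
      using y z unfolding tame_def by blast
    ultimately have "finite {q \<in> orbit K (u *\<^sub>R y + v *\<^sub>R z). ht (x - q) \<le> M}" for M
      by (meson finite_imageI finite_subset)
    moreover have "\<forall>q\<in>orbit K (u *\<^sub>R y + v *\<^sub>R z). x - q \<in> nonneg_cone K"
    proof
      fix q assume "q \<in> orbit K (u *\<^sub>R y + v *\<^sub>R z)"
      then obtain y' z' where "y' \<in> orbit K y" "z' \<in> orbit K z" "q = u *\<^sub>R y' + v *\<^sub>R z'"
        using orb by blast
      then show "x - q \<in> nonneg_cone K" using x nonneg_cone_comb[OF cone uv(1,2)] by simp
    qed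
    ultimately show ?thesis unfolding tame_def by blast
  qed (use y z in auto)
qed

lemma orbit_trans: "y \<in> orbit K x \<Longrightarrow> z \<in> orbit K y \<Longrightarrow> z \<in> orbit K x"
proof -
  assume "y \<in> orbit K x" "z \<in> orbit K y"
  then obtain w w' where "w \<in> lists K" "y = foldr r w x" "w' \<in> lists K" "z = foldr r w' y"
    by (auto simp: orbit_def)
  then show ?thesis unfolding orbit_def by (intro image_eqI[where x = "w' @ w"]) auto
qed

lemma orbit_sym: "y \<in> orbit K x \<Longrightarrow> x \<in> orbit K y"
proof -
  assume "y \<in> orbit K x"
  then obtain w where w: "w \<in> lists K" "y = foldr r w x" by (auto simp: orbit_def)
  then have "x = foldr r (rev w) y" by simp
  moreover have "rev w \<in> lists K" using w(1) by auto
  ultimately show ?thesis unfolding orbit_def by blast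
qed

lemma hull_subset_tame:
  assumes x: "\<forall>j\<in>K. 0 \<le> p x (c j)"
  shows "convex hull (orbit K x) \<subseteq> tame K x"
proof (rule hull_minimal[where S = convex, OF subsetI convex_tame])
  fix y assume y: "y \<in> orbit K x"
  then have "orbit K y = orbit K x" using orbit_trans orbit_sym by blast
  moreover have "\<forall>z\<in>orbit K x. x - z \<in> nonneg_cone K"
    using word_in_cone[OF _ x] by (auto simp: orbit_def)
  ultimately show "y \<in> tame K x" using finite_orbit_bounded[OF x] by (simp add: tame_def)
qed

lemma hull_in_cone:
  assumes "\<forall>j\<in>K. 0 \<le> p x (c j)" "y \<in> convex hull (orbit K x)"
  shows "x - y \<in> nonneg_cone K"
  using hull_subset_tame[OF assms(1)] assms(2) orbit_self unfolding tame_def by blast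

lemma hull_conjugate:
  assumes x: "\<forall>j\<in>K. 0 \<le> p x (c j)" and y: "y \<in> convex hull (orbit K x)"
  shows "\<exists>z\<in>orbit K y. \<forall>j\<in>K. 0 \<le> p z (c j)"
proof -
  define S where "S = {z \<in> orbit K y. ht (x - z) \<le> ht (x - y)}"
  have fin: "finite S" using hull_subset_tame[OF x] y unfolding tame_def S_def by blast
  have "y \<in> S" using orbit_self by (simp add: S_def)
  then have ne: "S \<noteq> {}" by blast
  obtain z where z: "z \<in> S" "\<And>z'. z' \<in> S \<Longrightarrow> ht (x - z) \<le> ht (x - z')"
    using arg_min_if_finite(1)[OF fin ne, of "\<lambda>z. ht (x - z)"]
      arg_min_least[OF fin ne, of _ "\<lambda>z. ht (x - z)"] by (rule that)
  have "0 \<le> p z (c j)" if j: "j \<in> K" for j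
  proof (rule ccontr)
    assume "\<not> 0 \<le> p z (c j)"
    then have less: "ht (x - r j z) < ht (x - z)" by (simp add: reflection_def)
    then have "r j z \<in> S" using z(1) orbit_r j unfolding S_def by fastforce
    then show False using z(2) less by fastforce
  qed
  then show ?thesis using z(1) by (auto simp: S_def)
qed

subsection \<open>Invariant convex sets\<close>

text \<open>For generalized Cartan submatrices this is equivalent to all components being of finite type.\<close>

definition positive_type :: "'n set \<Rightarrow> bool" where
  "positive_type J \<longleftrightarrow> (\<exists>u. (\<forall>i\<in>J. 0 < u i) \<and> (\<forall>i\<in>J. 0 < (\<Sum>j\<in>J. B i j * u j)))"

text \<open>A discrete minimum principle: where \<open>v\<close> attains the value 0, only
  off-diagonal entries contribute.\<close>

lemma row_nonpos_at_zero:
  assumes "i \<in> J" "v i = 0" "\<forall>j\<in>J. 0 \<le> v j"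
  shows "(\<Sum>j\<in>J. B i j * v j) \<le> 0"
proof (rule sum_nonpos)
  fix j assume "j \<in> J"
  then show "B i j * v j \<le> 0"
    using assms B_off[of i j] by (cases "i = j") (auto simp: mult_nonpos_nonneg)
qed

lemma positive_type_mono:
  assumes "positive_type J" "J' \<subseteq> J"
  shows "positive_type J'"
proof -
  obtain u where u: "\<forall>i\<in>J. 0 < u i" "\<forall>i\<in>J. 0 < (\<Sum>j\<in>J. B i j * u j)"
    using assms(1) unfolding positive_type_def by blast
  have "0 < (\<Sum>j\<in>J'. B i j * u j)" if i: "i \<in> J'" for i
  proof -
    have "(\<Sum>j\<in>J - J'. B i j * u j) \<le> 0"
    proof (rule sum_nonpos)
      fix j assume "j \<in> J - J'"
      then show "B i j * u j \<le> 0"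
        using i u(1) by (intro mult_nonpos_nonneg B_off) (auto intro: less_imp_le)
    qed
    moreover have "(\<Sum>j\<in>J. B i j * u j) = (\<Sum>j\<in>J'. B i j * u j) + (\<Sum>j\<in>J - J'. B i j * u j)"
      using assms(2) by (subst sum.subset_diff[of J' J]) auto
    moreover have "0 < (\<Sum>j\<in>J. B i j * u j)" using u(2) i assms(2) by blast
    ultimately show ?thesis by linarith
  qed
  then show ?thesis using u(1) assms(2) unfolding positive_type_def by blast
qed

text \<open>Compare \<open>v\<close> with the largest multiple \<open>t u\<close> below it. If
  \<open>t < 0\<close>, then \<open>v - t u\<close> is nonnegative, vanishes at some
  \<open>i\<close>, and has a positive image at \<open>i\<close>, against the minimum
  principle.\<close>

lemma positive_type_monotone:
  assumes "positive_type J" and v: "\<forall>i\<in>J. 0 \<le> (\<Sum>j\<in>J. B i j * v j)"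
  shows "\<forall>i\<in>J. 0 \<le> v i"
proof (rule ccontr)
  assume "\<not> (\<forall>i\<in>J. 0 \<le> v i)"
  then obtain k where k: "k \<in> J" "v k < 0" by force
  obtain u where u: "\<forall>i\<in>J. 0 < u i" "\<forall>i\<in>J. 0 < (\<Sum>j\<in>J. B i j * u j)"
    using assms(1) unfolding positive_type_def by blast
  have J: "finite J" "J \<noteq> {}" using k by auto
  define i where "i = arg_min_on (\<lambda>i. v i / u i) J"
  define t where "t = v i / u i"
  have i: "i \<in> J" unfolding i_def using J by (rule arg_min_if_finite)
  have t: "t \<le> v l / u l" if "l \<in> J" for l
    unfolding t_def i_def using J that by (rule arg_min_least)
  have "v k / u k < 0" using k u(1) by (simp add: divide_neg_pos)
  then have "t < 0" using t[OF k(1)] by linarith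
  have "(\<Sum>j\<in>J. B i j * (v j - t * u j)) \<le> 0"
  proof (rule row_nonpos_at_zero[OF i])
    have "u i \<noteq> 0" using u(1) i by force
    then show "v i - t * u i = 0" by (simp add: t_def)
    show "\<forall>j\<in>J. 0 \<le> v j - t * u j"
    proof
      fix j assume "j \<in> J"
      then show "0 \<le> v j - t * u j" using t[of j] u(1) by (simp add: pos_le_divide_eq)
    qed
  qed
  moreover have "(\<Sum>j\<in>J. B i j * (v j - t * u j)) = (\<Sum>j\<in>J. B i j * v j) - t * (\<Sum>j\<in>J. B i j * u j)"
    by (simp add: right_diff_distrib sum_subtractf sum_distrib_left mult.left_commute)
  moreover have "0 < - t * (\<Sum>j\<in>J. B i j * u j)"
    using \<open>t < 0\<close> u(2) i by (intro mult_pos_pos) auto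
  ultimately show False using v i by force
qed

section \<open>Linear systems on blocks of the Cartan matrix\<close>

text \<open>Padding with the identity turns the submatrix into a square matrix over the whole index
  type with the same determinant, so that matrix theory applies.\<close>

definition block :: "'n set \<Rightarrow> real^'n^'n" where
  "block J = (\<chi> i j. if i \<in> J then (if j \<in> J then B i j else 0) else if i = j then 1 else 0)"

lemma block_mult: "(block J *v x) $ i = (if i \<in> J then (\<Sum>j\<in>J. B i j * x $ j) else x $ i)"
proof (cases "i \<in> J")
  case True
  have "(\<Sum>j\<in>UNIV. (if j \<in> J then B i j else 0) * x $ j) = (\<Sum>j\<in>J. B i j * x $ j)"
    by (rule sum.mono_neutral_cong_right) auto
  then show ?thesis using True by (simp add: matrix_vector_mult_def block_def)
next
  case False
  have "(\<Sum>j\<in>UNIV. (if i = j then 1 else 0) * x $ j) = (\<Sum>j\<in>UNIV. if i = j then x $ j else 0)"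
    by (rule sum.cong) auto
  then show ?thesis using False by (simp add: matrix_vector_mult_def block_def)
qed

lemma inj_block:
  assumes "\<And>v. \<forall>i\<in>J. (\<Sum>j\<in>J. B i j * v j) = 0 \<Longrightarrow> \<forall>i\<in>J. v i = 0"
  shows "inj ((*v) (block J))"
proof (rule linear_injective_0[THEN iffD2, OF matrix_vector_mul_linear], intro allI impI)
  fix x :: "real^'n" assume "block J *v x = 0"
  then have x: "(block J *v x) $ i = 0" for i by simp
  have "\<forall>i\<in>J. (\<Sum>j\<in>J. B i j * x $ j) = 0" using x unfolding block_mult by metis
  then have "\<forall>i\<in>J. x $ i = 0" by (rule assms)
  moreover have "x $ i = 0" if "i \<notin> J" for i using x[of i] that by (simp add: block_mult)
  ultimately show "x = 0" by (auto simp: vec_eq_iff)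
qed

lemma solvable:
  assumes "\<And>v. \<forall>i\<in>J. (\<Sum>j\<in>J. B i j * v j) = 0 \<Longrightarrow> \<forall>i\<in>J. v i = 0"
  shows "\<exists>y. \<forall>i\<in>J. (\<Sum>j\<in>J. B i j * y j) = b i"
proof -
  have "surj ((*v) (block J))"
    using inj_block[OF assms] by (intro linear_injective_imp_surjective) auto
  then obtain x where "block J *v x = (\<chi> i. b i)" by (metis surjD)
  then have "(block J *v x) $ i = b i" for i by simp
  then have "\<forall>i\<in>J. (\<Sum>j\<in>J. B i j * x $ j) = b i" unfolding block_mult by metis
  then show ?thesis by blast
qed

lemma det_block: "det (block J) = real_of_int (principal_minor A J)"
proof -
  let ?f = "\<lambda>q. of_int (sign q) * (\<Prod>i\<in>UNIV. block J $ i $ q i)"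
  have "det (block J) = (\<Sum>q | q permutes J. ?f q)"
    unfolding det_def
  proof (rule sum.mono_neutral_right)
    show "\<forall>q\<in>{q. q permutes UNIV} - {q. q permutes J}. ?f q = 0"
    proof
      fix q assume "q \<in> {q. q permutes (UNIV :: 'n set)} - {q. q permutes J}"
      then have q: "bij q" "\<not> q permutes J" by (auto simp: permutes_bij)
      then obtain i where i: "i \<notin> J" "q i \<noteq> i"
        unfolding permutes_def bij_iff by blast
      then have "block J $ i $ q i = 0" by (auto simp: block_def)
      then have "(\<Prod>i\<in>UNIV. block J $ i $ q i) = 0" by (intro prod_zero) auto
      then show "?f q = 0" by simp
    qed
  qed (auto simp: finite_permutations intro: permutes_subset)
  also have "\<dots> = (\<Sum>q | q permutes J. of_int (sign q * (\<Prod>i\<in>J. A $ i $ q i)))"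
  proof (rule sum.cong)
    fix q assume "q \<in> {q. q permutes J}"
    then have q: "q permutes J" by simp
    have "(\<Prod>i\<in>UNIV. block J $ i $ q i) = (\<Prod>i\<in>J. B i (q i))"
    proof (rule prod.mono_neutral_cong_right)
      show "\<forall>i\<in>UNIV - J. block J $ i $ q i = 1" using permutes_not_in[OF q] by (simp add: block_def)
      show "block J $ i $ q i = B i (q i)" if "i \<in> J" for i
        using that permutes_in_image[OF q] by (simp add: block_def)
    qed auto
    then show "?f q = of_int (sign q * (\<Prod>i\<in>J. A $ i $ q i))" by simp
  qed simp
  finally show ?thesis by (simp add: principal_minor_def)
qed

lemma principal_minor_nonzero:
  assumes "\<And>v. \<forall>i\<in>J. (\<Sum>j\<in>J. B i j * v j) = 0 \<Longrightarrow> \<forall>i\<in>J. v i = 0"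
  shows "principal_minor A J \<noteq> 0"
proof -
  have "invertible (block J)"
    using inj_block[OF assms] matrix_left_invertible_injective invertible_left_inverse by blast
  then have "det (block J) \<noteq> 0" by (simp add: invertible_det_nz)
  then show ?thesis by (simp add: det_block)
qed

lemma positive_type_kernel:
  assumes "positive_type J" "\<forall>i\<in>J. (\<Sum>j\<in>J. B i j * v j) = 0"
  shows "\<forall>i\<in>J. v i = 0"
proof -
  have "\<forall>i\<in>J. 0 \<le> v i"
    by (rule positive_type_monotone[OF assms(1)]) (use assms(2) in simp)
  moreover have "\<forall>i\<in>J. 0 \<le> - v i"
    by (rule positive_type_monotone[OF assms(1)]) (use assms(2) in \<open>simp add: sum_negf\<close>)
  ultimately show ?thesis by force
qed

lemma positive_type_solvable:
  assumes "positive_type J"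
  shows "\<exists>y. \<forall>i\<in>J. (\<Sum>j\<in>J. B i j * y j) = b i"
  by (rule solvable) (rule positive_type_kernel[OF assms])

lemma p_span:
  assumes "z \<in> span (a ` J)"
  shows "p z (c i) = (\<Sum>j\<in>J. B i j * coord j z)"
  by (subst span_coord[OF assms]) (simp only: p_linear pair mult.commute)

lemma span_zero_of_p_zero:
  assumes "positive_type J" "z \<in> span (a ` J)" "\<forall>i\<in>J. p z (c i) = 0"
  shows "z = 0"
proof -
  have "\<forall>i\<in>J. (\<Sum>j\<in>J. B i j * coord j z) = 0"
    using assms(3) p_span[OF assms(2)] by simp
  with assms(1) have "\<forall>j\<in>J. coord j z = 0" by (rule positive_type_kernel)
  then show ?thesis by (subst span_coord[OF assms(2)]) simp
qed

lemma orbit_subset: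
  assumes "\<And>y i. y \<in> S \<Longrightarrow> i \<in> K \<Longrightarrow> r i y \<in> S" "x \<in> S"
  shows "orbit K x \<subseteq> S"
proof -
  have "foldr r w x \<in> S" if "w \<in> lists K" for w
    using that by (induction w rule: list.induct) (use assms in auto)
  then show ?thesis by (auto simp: orbit_def)
qed

lemma a_nonzero: "a i \<noteq> 0"
  using coord(2)[of i i] coord_linear(5)[of i] by (metis zero_neq_one)

lemma r_span: "y \<in> span (a ` J) \<Longrightarrow> i \<in> J \<Longrightarrow> r i y \<in> span (a ` J)"
  unfolding reflection_def by (intro span_diff[OF _ span_scale[OF span_base]]) auto

text \<open>The average of the orbit is fixed by all reflections of \<open>J\<close>, and 0 is the
  only fixed vector in the span.\<close>

lemma zero_in_hull_of_finite_orbit: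
  assumes J: "positive_type J" and S: "convex S" "\<And>y i. y \<in> S \<Longrightarrow> i \<in> J \<Longrightarrow> r i y \<in> S"
    and x: "x \<in> S" "x \<in> span (a ` J)" and fin: "finite (orbit J x)"
  shows "0 \<in> S"
proof -
  define R where "R = orbit J x"
  define y where "y = (\<Sum>q\<in>R. (1 / card R) *\<^sub>R q)"
  have R: "finite R" "R \<noteq> {}" using fin orbit_self by (auto simp: R_def)
  have "R \<subseteq> S" unfolding R_def using S(2) x(1) by (rule orbit_subset)
  then have "y \<in> S" unfolding y_def using R S(1) by (intro convex_sum) auto
  have "R \<subseteq> span (a ` J)"
    unfolding R_def using r_span x(2) by (rule orbit_subset)
  then have "y \<in> span (a ` J)" unfolding y_def by (intro span_sum span_scale) auto
  moreover have "p y (c i) = 0" if i: "i \<in> J" for i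
  proof -
    have "r i y = (\<Sum>q\<in>R. (1 / card R) *\<^sub>R r i q)"
      unfolding y_def linear_sum[OF linear_r] linear_scale[OF linear_r] ..
    also have "\<dots> = y"
      unfolding y_def
      by (rule sum.reindex_bij_witness[of _ "r i" "r i"]) (use orbit_r i in \<open>auto simp: R_def\<close>)
    finally show ?thesis using a_nonzero by (simp add: reflection_def)
  qed
  ultimately have "y = 0" using J by (intro span_zero_of_p_zero[of J]) auto
  then show ?thesis using \<open>y \<in> S\<close> by simp
qed

text \<open>
  This replaces averaging over \<open>W\<^sub>J\<close>, whose finiteness is not available.  By induction it suffices
  that an invariant convex \<open>T\<close> containing a fundamental weight \<open>W j\<close> of \<open>J\<close> contains \<open>0\<close>.  Either
  some conjugate of \<open>W j\<close> has a nonpositive coefficient, and projecting it twice gives a nonpositive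
  multiple of \<open>W j\<close>; or the orbit lies between \<open>0\<close> and \<open>W j\<close>, hence is finite and averages to \<open>0\<close>.
\<close>

lemma fixed_point_in_invariant:
  assumes "positive_type J" "convex S" "\<And>y i. y \<in> S \<Longrightarrow> i \<in> J \<Longrightarrow> r i y \<in> S" "x \<in> S"
  shows "\<exists>y\<in>S. y - x \<in> span (a ` J) \<and> (\<forall>i\<in>J. p y (c i) = 0)"
  using assms
proof (induction "card J" arbitrary: J S x rule: less_induct)
  case less
  note J = less.prems(1)
  show ?case
  proof (cases "J = {}")
    case True
    then show ?thesis using less.prems(4) span_zero by (intro bexI[of _ x]) auto
  next
    case False
    then obtain j where j: "j \<in> J" by blast
    have "\<exists>y. \<forall>k\<in>J. (\<Sum>l\<in>J. B k l * y l) = (if k = i then 1 else 0)" for i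
      using J by (rule positive_type_solvable)
    \<comment> \<open>\<open>Y i\<close> is a column of the inverse of the block. It holds the
      coordinates of \<open>W i\<close>, the fundamental weight inside the span of the roots of
      \<open>J\<close>.\<close>
    then obtain Y where Y: "\<And>i k. k \<in> J \<Longrightarrow> (\<Sum>l\<in>J. B k l * Y i l) = (if k = i then 1 else 0)"
      by metis
    have Ynn: "0 \<le> Y i k" if "k \<in> J" for i k
      using positive_type_monotone[OF J, of "Y i"] Y that by simp
    have Ypos: "0 < Y i i" if "i \<in> J" for i
    proof (rule ccontr)
      assume "\<not> 0 < Y i i"
      then have "Y i i = 0" using Ynn[OF that, of i] by simp
      then have "(\<Sum>l\<in>J. B i l * Y i l) \<le> 0" using Ynn that by (intro row_nonpos_at_zero) auto
      then show False using Y[OF that, of i] by simp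
    qed
    define W where "W i = (\<Sum>l\<in>J. Y i l *\<^sub>R a l)" for i
    have W_span: "W i \<in> span (a ` J)" for i unfolding W_def by (rule sum_in_span)
    have W_coord: "coord k (W i) = Y i k" if "k \<in> J" for i k
      unfolding W_def using that by (simp only: coord_sum finite if_True)
    have W_p: "p (W i) (c k) = (if k = i then 1 else 0)" if "k \<in> J" for i k
      using p_span[OF W_span] W_coord Y that by (simp cong: sum.cong)
    have multiple: "z = p z (c i) *\<^sub>R W i"
      if z: "z \<in> span (a ` J)" "\<forall>k\<in>J - {i}. p z (c k) = 0" for z i
    proof -
      have "z - p z (c i) *\<^sub>R W i = 0"
        using z W_p by (intro span_zero_of_p_zero[OF J]) (auto intro: span_diff span_scale W_span)
      then show ?thesis by simp
    qed
    \<comment> \<open>The induction hypothesis for \<open>J - {i}\<close> moves \<open>z\<close> by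
      roots other than \<open>a i\<close>. The result is a multiple of \<open>W i\<close> with the
      coordinate of \<open>z\<close> along \<open>a i\<close>, which determines the factor.\<close>
    have project: "\<exists>t. t *\<^sub>R W i \<in> T \<and> t * Y i i = coord i z"
      if T: "convex T" "\<And>y k. y \<in> T \<Longrightarrow> k \<in> J \<Longrightarrow> r k y \<in> T" and z: "z \<in> T" "z \<in> span (a ` J)"
        and i: "i \<in> J" for T z i
    proof -
      have "card (J - {i}) < card J" using i by (intro psubset_card_mono) auto
      moreover have "positive_type (J - {i})" using J by (rule positive_type_mono) auto
      ultimately obtain y where y: "y \<in> T" "y - z \<in> span (a ` (J - {i}))" "\<forall>k\<in>J - {i}. p y (c k) = 0"
        using less.hyps[of "J - {i}" T z] T z(1) by blast
      have "y - z \<in> span (a ` J)" using y(2) span_mono[of "a ` (J - {i})" "a ` J"] by blast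
      then have "y \<in> span (a ` J)" using span_add[OF _ z(2)] by force
      then have eq: "y = p y (c i) *\<^sub>R W i" using y(3) by (rule multiple)
      have "coord i (y - z) = 0" using y(2) by (rule coord_outside) simp
      moreover have "coord i y = p y (c i) * Y i i" by (subst eq) (simp add: W_coord i)
      ultimately show ?thesis using y(1) eq by (intro exI[of _ "p y (c i)"]) auto
    qed
    have zero: "0 \<in> T" if T: "convex T" "\<And>y k. y \<in> T \<Longrightarrow> k \<in> J \<Longrightarrow> r k y \<in> T" and W: "W j \<in> T" for T
    proof (cases "\<exists>q\<in>orbit J (W j). \<exists>i\<in>J. coord i q \<le> 0")
      case True
      then obtain q i where q: "q \<in> orbit J (W j)" "i \<in> J" "coord i q \<le> 0" by blast
      have "q \<in> T" using orbit_subset[of T J "W j"] T(2) W q(1) by blast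
      moreover have "q \<in> span (a ` J)"
      proof -
        have "orbit J (W j) \<subseteq> span (a ` J)"
          using r_span W_span by (rule orbit_subset)
        then show ?thesis using q(1) by blast
      qed
      ultimately obtain t where t: "t *\<^sub>R W i \<in> T" "t * Y i i = coord i q"
        using project[of T q i] T q(2) by blast
      have "t \<le> 0" using t(2) q(3) Ypos[OF q(2)] by (metis mult_le_0_iff not_le)
      obtain s where s: "s *\<^sub>R W j \<in> T" "s * Y j j = coord j (t *\<^sub>R W i)"
        using project[of T "t *\<^sub>R W i" j] T t(1) j span_scale[OF W_span] by blast
      have "s * Y j j \<le> 0" using s(2) \<open>t \<le> 0\<close> Ynn[OF j, of i] W_coord[OF j]
        by (simp add: mult_nonpos_nonneg)
      then have "s \<le> 0" using Ypos[OF j] by (metis mult_le_0_iff not_le)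
      \<comment> \<open>As \<open>s\<close> is not positive, 0 lies between \<open>W j\<close> and
        its multiple by \<open>s\<close>; these are the balancing weights.\<close>
      have "(- s / (1 - s)) *\<^sub>R W j + (1 / (1 - s)) *\<^sub>R (s *\<^sub>R W j) \<in> T"
        using T(1) W s(1) \<open>s \<le> 0\<close> by (intro convexD) (auto simp: field_simps)
      moreover have "(- s / (1 - s)) *\<^sub>R W j + (1 / (1 - s)) *\<^sub>R (s *\<^sub>R W j) = 0"
        by simp
      ultimately show ?thesis by simp
    next
      case False
      have dom: "\<forall>k\<in>J. 0 \<le> p (W j) (c k)" using W_p by simp
      have "orbit J (W j) \<subseteq> {q \<in> orbit J (W j). ht (W j - q) \<le> ht (W j)}"
      proof
        fix q assume q: "q \<in> orbit J (W j)"
        then have "W j - q \<in> span (a ` J)"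
          using word_in_cone[OF _ dom] by (auto simp: orbit_def nonneg_cone_def)
        then have "coord k q = coord k (W j)" if "k \<notin> J" for k using coord_outside that by fastforce
        then have "0 \<le> coord k q" for k
          using False q coord_outside[OF W_span] by (cases "k \<in> J") force+
        then have "0 \<le> ht q" unfolding ht_def by (intro sum_nonneg)
        then show "q \<in> {q \<in> orbit J (W j). ht (W j - q) \<le> ht (W j)}" using q by simp
      qed
      then have "finite (orbit J (W j))" using finite_orbit_bounded[OF dom] by (rule finite_subset)
      with J T W W_span show ?thesis by (rule zero_in_hull_of_finite_orbit)
    qed
    obtain y0 where y0: "\<forall>k\<in>J. (\<Sum>l\<in>J. B k l * y0 l) = p x (c k)"
      using positive_type_solvable[OF J, of "\<lambda>k. p x (c k)"] by blast
    \<comment> \<open>\<open>x0\<close> is the desired fixed point. The point \<open>x1\<close>,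
      fixed for \<open>J - {j}\<close>, will differ from it by a multiple of \<open>W j\<close>.
      Since \<open>x0\<close> is fixed, \<open>z \<mapsto> x0 + t z\<close> commutes with the
      reflections, and \<open>zero\<close> applies to the preimage of \<open>S\<close>.\<close>
    define x0 where "x0 = x - (\<Sum>l\<in>J. y0 l *\<^sub>R a l)"
    have x0: "\<forall>k\<in>J. p x0 (c k) = 0" "x0 - x \<in> span (a ` J)"
      using y0 sum_in_span[of y0 J] by (auto simp: x0_def mult.commute span_neg)
    have "card (J - {j}) < card J" using j by (intro psubset_card_mono) auto
    moreover have "positive_type (J - {j})" using J by (rule positive_type_mono) auto
    ultimately obtain x1 where x1: "x1 \<in> S" "x1 - x \<in> span (a ` (J - {j}))" "\<forall>k\<in>J - {j}. p x1 (c k) = 0"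
      using less.hyps[of "J - {j}" S x] less.prems by blast
    have "x1 - x \<in> span (a ` J)" using x1(2) span_mono[of "a ` (J - {j})" "a ` J"] by blast
    then have "x1 - x0 \<in> span (a ` J)" using span_diff[OF _ x0(2)] by force
    then have "x1 - x0 = p (x1 - x0) (c j) *\<^sub>R W j" using x0 x1 by (intro multiple) auto
    then obtain t where t: "x1 = x0 + t *\<^sub>R W j" by (metis add.commute diff_add_cancel)
    have "x0 \<in> S"
    proof -
      have "0 \<in> {z. x0 + t *\<^sub>R z \<in> S}"
      proof (rule zero)
        show "convex {z. x0 + t *\<^sub>R z \<in> S}"
        proof (rule convexI, clarify)
          fix y z :: 'v and u v :: real
          assume yz: "x0 + t *\<^sub>R y \<in> S" "x0 + t *\<^sub>R z \<in> S" and uv: "0 \<le> u" "0 \<le> v" "u + v = 1"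
          have "u *\<^sub>R (x0 + t *\<^sub>R y) + v *\<^sub>R (x0 + t *\<^sub>R z) \<in> S"
            using less.prems(2) yz uv by (rule convexD)
          moreover have "u *\<^sub>R (x0 + t *\<^sub>R y) + v *\<^sub>R (x0 + t *\<^sub>R z) =
              (u + v) *\<^sub>R x0 + t *\<^sub>R (u *\<^sub>R y + v *\<^sub>R z)"
            by (simp add: algebra_simps)
          ultimately show "x0 + t *\<^sub>R (u *\<^sub>R y + v *\<^sub>R z) \<in> S" using uv(3) by simp
        qed
        fix y k assume y: "y \<in> {z. x0 + t *\<^sub>R z \<in> S}" "k \<in> J"
        have "r k (x0 + t *\<^sub>R y) = x0 + t *\<^sub>R r k y"
          using x0(1) y(2) by (simp add: reflection_def algebra_simps)
        then show "r k y \<in> {z. x0 + t *\<^sub>R z \<in> S}" using less.prems(3)[of "x0 + t *\<^sub>R y" k] y by simp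
      next
        show "W j \<in> {z. x0 + t *\<^sub>R z \<in> S}" using t x1(1) by simp
      qed
      then show ?thesis by simp
    qed
    then show ?thesis using x0 by blast
  qed
qed

section \<open>Moving inside invariant convex sets\<close>

definition invariant :: "'n set \<Rightarrow> 'v set \<Rightarrow> bool" where
  "invariant K S \<longleftrightarrow> convex S \<and> (\<forall>y\<in>S. \<forall>i\<in>K. r i y \<in> S)"

lemma invariant_step:
  assumes "invariant K S" "x \<in> S" "\<forall>i\<in>K. 0 \<le> s i" "(\<Sum>i\<in>K. s i) \<le> 1"
  shows "x - (\<Sum>i\<in>K. (s i * p x (c i)) *\<^sub>R a i) \<in> S"
proof (cases "(\<Sum>i\<in>K. s i) = 0")
  case True
  then have "\<forall>i\<in>K. s i = 0" using assms(3) by (subst (asm) sum_nonneg_eq_0_iff) auto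
  then show ?thesis using assms(2) by simp
next
  case False
  define t where "t = (\<Sum>i\<in>K. s i)"
  have t: "0 < t" "t \<le> 1" using False assms(3,4) sum_nonneg[of K s] by (auto simp: t_def less_le)
  have S: "convex S" "\<And>y i. y \<in> S \<Longrightarrow> i \<in> K \<Longrightarrow> r i y \<in> S" using assms(1) by (auto simp: invariant_def)
  have "(\<Sum>i\<in>K. (s i / t) *\<^sub>R r i x) \<in> S"
    using S assms(2,3) t by (intro convex_sum) (auto simp: t_def sum_divide_distrib[symmetric])
  then have "(1 - t) *\<^sub>R x + t *\<^sub>R (\<Sum>i\<in>K. (s i / t) *\<^sub>R r i x) \<in> S"
    using S(1) assms(2) t by (intro convexD) auto
  also have "t *\<^sub>R (\<Sum>i\<in>K. (s i / t) *\<^sub>R r i x) = (\<Sum>i\<in>K. s i *\<^sub>R r i x)"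
    using t by (simp add: scaleR_sum_right)
  also have "\<dots> = t *\<^sub>R x - (\<Sum>i\<in>K. (s i * p x (c i)) *\<^sub>R a i)"
    by (simp add: reflection_def t_def scaleR_sum_left scaleR_diff_right sum_subtractf)
  finally show ?thesis by (simp add: algebra_simps)
qed

text \<open>The segment from \<open>x\<close> to \<open>y\<close> is cut into \<open>N\<close> equal
  pieces. All values on coroots of \<open>K\<close> stay at least \<open>d\<close> along it, so a
  piece starting at \<open>z\<close> is an \<open>invariant_step\<close> with
  \<open>s i = m i / (N * p z (c i))\<close>, and a large \<open>N\<close> keeps the sum of these
  weights at most 1.\<close>

lemma regular_reachable:
  assumes S: "invariant K S" and x: "x \<in> S" "\<forall>i\<in>K. 0 < p x (c i)"
    and y: "\<forall>i\<in>K. 0 < p y (c i)" "x - y \<in> nonneg_cone K"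
  shows "y \<in> S"
proof -
  define m where "m i = coord i (x - y)" for i
  have m: "0 \<le> m i" for i unfolding m_def using y(2) by (rule nonneg_cone_coord)
  have xy: "x - y = (\<Sum>i\<in>K. m i *\<^sub>R a i)"
    unfolding m_def by (rule span_coord) (use y(2) in \<open>simp add: nonneg_cone_def\<close>)
  have "\<exists>d>0. d \<le> 1 \<and> (\<forall>i\<in>K. d * 1 < min (p x (c i)) (p y (c i)))"
    using x(2) y(1) by (intro small_multiple) auto
  then obtain d where d: "0 < d" "\<forall>i\<in>K. d < p x (c i) \<and> d < p y (c i)" by auto
  obtain N :: nat where N: "(\<Sum>i\<in>K. m i) / d < N" using reals_Archimedean2 by blast
  moreover have "0 \<le> (\<Sum>i\<in>K. m i) / d" using m d by (simp add: sum_nonneg)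
  ultimately have N0: "0 < real N" by linarith
  have Nd: "(\<Sum>i\<in>K. m i) \<le> N * d" using N d by (simp add: pos_divide_less_eq less_imp_le)
  have "x - (real k / N) *\<^sub>R (x - y) \<in> S" if "k \<le> N" for k
    using that
  proof (induction k)
    case 0
    then show ?case using x by simp
  next
    case (Suc k)
    define z where "z = x - (real k / N) *\<^sub>R (x - y)"
    have z: "z \<in> S" using Suc by (simp add: z_def)
    have dz: "d \<le> p z (c i)" if i: "i \<in> K" for i
    proof -
      have k: "0 \<le> real k / N" "real k / N \<le> 1" using Suc.prems N0 by auto
      have "d = (1 - real k / N) * d + (real k / N) * d" by (simp add: algebra_simps)
      also have "\<dots> \<le> (1 - real k / N) * p x (c i) + (real k / N) * p y (c i)"
        using d i k by (intro add_mono mult_left_mono) (auto intro: less_imp_le)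
      also have "\<dots> = p z (c i)" by (simp add: z_def algebra_simps)
      finally show ?thesis .
    qed
    define s where "s i = m i / (N * p z (c i))" for i
    have "s i \<le> m i / (N * d)" if i: "i \<in> K" for i
      unfolding s_def using dz[OF i] d(1) N0 m by (intro divide_left_mono mult_left_mono mult_pos_pos) auto
    then have "(\<Sum>i\<in>K. s i) \<le> (\<Sum>i\<in>K. m i / (N * d))" by (rule sum_mono)
    also have "\<dots> \<le> 1" using Nd N0 d(1) by (simp add: sum_divide_distrib[symmetric])
    finally have "z - (\<Sum>i\<in>K. (s i * p z (c i)) *\<^sub>R a i) \<in> S"
      using dz d(1) N0 m by (intro invariant_step[OF S z]) (force simp: s_def)+
    also have "(\<Sum>i\<in>K. (s i * p z (c i)) *\<^sub>R a i) = (\<Sum>i\<in>K. (1 / N) *\<^sub>R (m i *\<^sub>R a i))"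
    proof (rule sum.cong)
      fix i assume "i \<in> K"
      then have "p z (c i) \<noteq> 0" using dz d(1) by force
      then show "(s i * p z (c i)) *\<^sub>R a i = (1 / N) *\<^sub>R (m i *\<^sub>R a i)" by (simp add: s_def)
    qed simp
    also have "\<dots> = (1 / N) *\<^sub>R (x - y)" unfolding xy by (simp add: scaleR_sum_right)
    also have "z - \<dots> = x - (real k / N + 1 / N) *\<^sub>R (x - y)"
      unfolding z_def scaleR_add_left by simp
    also have "real k / N + 1 / N = real (Suc k) / N" by (simp add: add_divide_distrib)
    finally show ?case .
  qed
  from this[of N] show ?thesis using N0 by simp
qed

text \<open>Being \<mu>-connected, recast as a growth condition suited to an iteration that enlarges
  a set of indices.\<close>

definition positivity_spreads :: "'n set \<Rightarrow> 'v \<Rightarrow> bool" where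
  "positivity_spreads I \<mu> \<longleftrightarrow> (\<forall>Z. {i \<in> I. 0 < p \<mu> (c i)} \<subseteq> Z \<longrightarrow> Z \<subset> I \<longrightarrow>
     (\<exists>i\<in>I - Z. \<exists>k\<in>Z. A $ i $ k \<noteq> 0))"

text \<open>
  A small simultaneous step keeps the positive values on coroots positive and makes the values at
  neighbours of positive ones positive, so positivity spreads along the edges of \<open>I\<close>.
\<close>

lemma regular_point:
  assumes conn: "positivity_spreads I \<mu>"
    and \<mu>: "\<forall>i\<in>I. 0 \<le> p \<mu> (c i)" and S: "invariant I S" "\<mu> \<in> S"
  shows "\<exists>x\<in>S. \<mu> - x \<in> span (a ` I) \<and> (\<forall>i\<in>I. 0 < coord i (\<mu> - x) \<and> 0 < p x (c i))"
proof -
  \<comment> \<open>Two demands: the weights sum to at most 1, and \<open>2 * t < 1\<close> keeps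
    positive values positive. The summand 3 secures the latter even for empty
    \<open>I\<close>.\<close>
  define t where "t = 1 / (real (card I) + 3)"
  have t: "0 < t" "2 * t < 1" "card I * t \<le> 1" by (auto simp: t_def field_simps)
  define T where "T x = x - (\<Sum>i\<in>I. (t * p x (c i)) *\<^sub>R a i)" for x
  define Z where "Z x = {i \<in> I. 0 < p x (c i)}" for x
  define G where "G = {x \<in> S. \<mu> - x \<in> nonneg_cone I \<and> (\<forall>i\<in>I. 0 \<le> p x (c i)) \<and> Z \<mu> \<subseteq> Z x}"
  have coord_T: "coord i (\<mu> - T x) = coord i (\<mu> - x) + t * p x (c i)" if "i \<in> I" for i x
  proof -
    have "coord i (\<Sum>i\<in>I. (t * p x (c i)) *\<^sub>R a i) = t * p x (c i)"
      using that by (simp only: coord_sum finite if_True)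
    then show ?thesis by (simp only: T_def coord_linear)
  qed
  have p_T: "p (T x) (c k) = (1 - 2 * t) * p x (c k) + (\<Sum>i\<in>I - {k}. t * (- B k i) * p x (c i))"
    if k: "k \<in> I" for x k
  proof -
    have "p (T x) (c k) = p x (c k) - (\<Sum>i\<in>I. t * B k i * p x (c i))"
      by (simp add: T_def mult_ac)
    also have "(\<Sum>i\<in>I. t * B k i * p x (c i)) = t * 2 * p x (c k) + (\<Sum>i\<in>I - {k}. t * B k i * p x (c i))"
      using k by (simp add: sum.remove)
    finally show ?thesis by (simp add: algebra_simps sum_negf)
  qed
  have nn: "0 \<le> t * (- B k i) * p x (c i)" if "x \<in> G" "i \<in> I - {k}" for x k i
  proof -
    have "0 \<le> - B k i" "0 \<le> p x (c i)" using that B_off[of k i] by (auto simp: G_def)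
    then show ?thesis using t(1) by (intro mult_nonneg_nonneg) auto
  qed
  have T_ge: "(1 - 2 * t) * p x (c k) \<le> p (T x) (c k)" if "x \<in> G" "k \<in> I" for x k
  proof -
    have "0 \<le> (\<Sum>i\<in>I - {k}. t * (- B k i) * p x (c i))" using nn[OF that(1)] by (rule sum_nonneg)
    then show ?thesis unfolding p_T[OF that(2)] by linarith
  qed
  have Z_T: "Z x \<subseteq> Z (T x)" if x: "x \<in> G" for x
  proof
    fix k assume "k \<in> Z x"
    then have k: "k \<in> I" "0 < p x (c k)" by (auto simp: Z_def)
    have "0 < (1 - 2 * t) * p x (c k)" using k t by simp
    then show "k \<in> Z (T x)" using T_ge[OF x k(1)] k(1) by (simp add: Z_def)
  qed
  have G_T: "T x \<in> G" if x: "x \<in> G" for x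
  proof -
    have x': "x \<in> S" "\<mu> - x \<in> nonneg_cone I" "\<forall>i\<in>I. 0 \<le> p x (c i)" "Z \<mu> \<subseteq> Z x"
      using x by (auto simp: G_def)
    have "T x \<in> S" unfolding T_def using x'(1) t by (intro invariant_step[OF S(1)]) auto
    moreover have "\<mu> - T x \<in> nonneg_cone I"
    proof -
      have "\<mu> - T x = (\<mu> - x) + (\<Sum>i\<in>I. (t * p x (c i)) *\<^sub>R a i)" by (simp add: T_def)
      then have "\<mu> - T x \<in> span (a ` I)"
        using x'(2) by (simp only: nonneg_cone_def mem_Collect_eq span_add sum_in_span)
      moreover have "0 \<le> coord i (\<mu> - T x)" if i: "i \<in> I" for i
        unfolding coord_T[OF i] using nonneg_cone_coord[OF x'(2)] x'(3) i t(1)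
        by (intro add_nonneg_nonneg mult_nonneg_nonneg) auto
      ultimately show ?thesis by (simp add: nonneg_cone_def)
    qed
    moreover have "0 \<le> p (T x) (c i)" if i: "i \<in> I" for i
    proof -
      have "0 \<le> (1 - 2 * t) * p x (c i)" using x'(3) i t by simp
      then show ?thesis using T_ge[OF x i] by linarith
    qed
    ultimately show ?thesis using Z_T[OF x] x'(4) by (auto simp: G_def)
  qed
  have grow: "Z x \<subset> Z (T x)" if x: "x \<in> G" and neq: "Z x \<noteq> I" for x
  proof -
    have "Z x \<subset> I" using neq by (auto simp: Z_def)
    moreover have "{i \<in> I. 0 < p \<mu> (c i)} \<subseteq> Z x" using x by (simp add: G_def Z_def)
    ultimately obtain k i where ki: "k \<in> I - Z x" "i \<in> Z x" "A $ k $ i \<noteq> 0"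
      using conn unfolding positivity_spreads_def by meson
    then have i: "i \<in> I - {k}" "k \<in> I" "0 < p x (c i)" by (auto simp: Z_def)
    have "0 < - B k i" using ki(3) A_off[of k i] i by auto
    then have "0 < t * (- B k i) * p x (c i)" using t i by (intro mult_pos_pos) auto
    also have "\<dots> \<le> (\<Sum>i\<in>I - {k}. t * (- B k i) * p x (c i))"
      using nn[OF x] i(1) by (intro member_le_sum) auto
    also have "\<dots> \<le> p (T x) (c k)"
      unfolding p_T[OF i(2)] using x i(2) t by (simp add: G_def)
    finally have "k \<in> Z (T x)" using i by (simp add: Z_def)
    then show ?thesis using Z_T[OF x] ki(1) by blast
  qed
  have "\<exists>y\<in>G. Z y = I" if "x \<in> G" for x
    using that
  proof (induction "card (I - Z x)" arbitrary: x rule: less_induct)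
    case less
    show ?case
    proof (cases "Z x = I")
      case False
      have "Z (T x) \<subseteq> I" by (auto simp: Z_def)
      then have "I - Z (T x) \<subset> I - Z x" using grow[OF less.prems False] by blast
      then have "card (I - Z (T x)) < card (I - Z x)" by (intro psubset_card_mono) auto
      then show ?thesis using less.hyps G_T[OF less.prems] by blast
    qed (use less.prems in blast)
  qed
  moreover have "\<mu> \<in> G" using \<mu> S by (simp add: G_def nonneg_cone_def span_zero)
  ultimately obtain y where y: "y \<in> G" "Z y = I" by blast
  \<comment> \<open>One more step after all values are positive: it adds a positive amount to every
    coordinate of the difference from \<mu>.\<close>
  have Ty: "T y \<in> G" using y(1) by (rule G_T)
  have "Z (T y) = I" using Z_T[OF y(1)] y(2) by (auto simp: Z_def)
  then have 1: "\<forall>i\<in>I. 0 < p (T y) (c i)" by (auto simp: Z_def)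
  have 2: "0 < coord i (\<mu> - T y)" if i: "i \<in> I" for i
  proof -
    have "0 < p y (c i)" using i y(2) by (auto simp: Z_def)
    then have "0 < t * p y (c i)" using t by simp
    moreover have "0 \<le> coord i (\<mu> - y)" using y(1) by (intro nonneg_cone_coord[of _ I]) (simp add: G_def)
    ultimately show ?thesis unfolding coord_T[OF i] by linarith
  qed
  show ?thesis using Ty 1 2 by (intro bexI[of _ "T y"]) (auto simp: G_def nonneg_cone_def)
qed

lemma invariant_hull: "invariant K (convex hull (orbit K x))"
proof -
  have "r i ` (convex hull (orbit K x)) \<subseteq> convex hull (orbit K x)" if "i \<in> K" for i
    unfolding convex_hull_linear_image[OF linear_r] using orbit_r that by (intro hull_mono) blast
  then show ?thesis unfolding invariant_def by (auto simp: convex_convex_hull)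
qed

lemma invariant_rel_interior:
  assumes "invariant K S"
  shows "invariant K (rel_interior S)"
proof -
  have S: "convex S" "\<And>y i. y \<in> S \<Longrightarrow> i \<in> K \<Longrightarrow> r i y \<in> S" using assms by (auto simp: invariant_def)
  have "r i ` S = S" if "i \<in> K" for i
  proof
    show "S \<subseteq> r i ` S" using S(2)[OF _ that] by (metis image_eqI r_r subsetI)
  qed (use S(2) that in blast)
  then have "r i ` rel_interior S = rel_interior S" if "i \<in> K" for i
    using rel_interior_convex_linear_image[OF linear_r S(1)] that by metis
  then show ?thesis unfolding invariant_def using S(1) by (auto simp: convex_rel_interior)
qed

subsection \<open>The relative interior of the face\<close>

text \<open>The point \<open>x\<close> given by \<open>regular_point\<close> need not lie above
  \<eta>. Sliding it towards \<mu> keeps its values positive and brings it above \<eta>, which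
  \<open>regular_reachable\<close> then reaches.\<close>

lemma regular_in_hull:
  assumes conn: "positivity_spreads I \<mu>"
    and \<mu>: "\<forall>i\<in>I. 0 \<le> p \<mu> (c i)"
    and \<eta>: "\<mu> - \<eta> \<in> span (a ` I)" "\<forall>i\<in>I. 0 < coord i (\<mu> - \<eta>)" "\<forall>i\<in>I. 0 < p \<eta> (c i)"
  shows "\<eta> \<in> convex hull (orbit I \<mu>)"
proof -
  let ?F = "convex hull (orbit I \<mu>)"
  have \<mu>F: "\<mu> \<in> ?F" by (intro hull_inc orbit_self)
  obtain x where x: "x \<in> ?F" "\<mu> - x \<in> span (a ` I)" "\<forall>i\<in>I. 0 < coord i (\<mu> - x) \<and> 0 < p x (c i)"
    using regular_point[OF conn \<mu> invariant_hull \<mu>F] by blast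
  obtain s where s: "0 < s" "s \<le> 1" "\<forall>i\<in>I. s * coord i (\<mu> - x) < coord i (\<mu> - \<eta>)"
    using small_multiple[of I "\<lambda>i. coord i (\<mu> - \<eta>)" "\<lambda>i. coord i (\<mu> - x)"] \<eta>(2) by auto
  define y where "y = (1 - s) *\<^sub>R \<mu> + s *\<^sub>R x"
  have y: "y = \<mu> - s *\<^sub>R (\<mu> - x)" by (simp add: y_def algebra_simps)
  show ?thesis
  proof (rule regular_reachable[OF invariant_hull _ _ \<eta>(3)])
    show "y \<in> ?F" unfolding y_def using \<mu>F x(1) s by (intro convexD convex_convex_hull) auto
    show "\<forall>i\<in>I. 0 < p y (c i)"
      unfolding y_def using \<mu> x(3) s by (auto intro!: add_nonneg_pos mult_nonneg_nonneg mult_pos_pos)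
    have eq: "y - \<eta> = (\<mu> - \<eta>) - s *\<^sub>R (\<mu> - x)" by (simp add: y)
    have "y - \<eta> \<in> span (a ` I)" unfolding eq using \<eta>(1) x(2) by (simp only: span_diff span_scale)
    moreover have "coord i (y - \<eta>) = coord i (\<mu> - \<eta>) - s * coord i (\<mu> - x)" for i
      unfolding eq by simp
    ultimately show "y - \<eta> \<in> nonneg_cone I"
      using s(3) unfolding nonneg_cone_def by (auto intro: less_imp_le simp del: coord_linear)
  qed
qed

lemma p_below:
  assumes "\<mu> - \<eta> \<in> span (a ` I)"
  shows "p \<eta> (c i) = p \<mu> (c i) - (\<Sum>k\<in>I. B i k * coord k (\<mu> - \<eta>))"
proof -
  have "p \<eta> (c i) = p \<mu> (c i) - p (\<mu> - \<eta>) (c i)" by simp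
  also have "p (\<mu> - \<eta>) (c i) = (\<Sum>k\<in>I. B i k * coord k (\<mu> - \<eta>))" using assms by (rule p_span)
  finally show ?thesis .
qed

lemma affine_hull_in_span:
  assumes "x \<in> affine hull (convex hull (orbit I \<mu>))"
  shows "\<mu> - x \<in> span (a ` I)"
proof -
  let ?U = "{x. \<mu> - x \<in> span (a ` I)}"
  have "affine ?U"
    unfolding affine_def
  proof clarify
    fix x y :: 'v and u v :: real
    assume "\<mu> - x \<in> span (a ` I)" "\<mu> - y \<in> span (a ` I)" and uv: "u + v = 1"
    then have "u *\<^sub>R (\<mu> - x) + v *\<^sub>R (\<mu> - y) \<in> span (a ` I)" by (intro span_add span_scale)
    moreover have "u *\<^sub>R (\<mu> - x) + v *\<^sub>R (\<mu> - y) = (u + v) *\<^sub>R \<mu> - (u *\<^sub>R x + v *\<^sub>R y)"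
      by (simp add: algebra_simps)
    ultimately show "\<mu> - (u *\<^sub>R x + v *\<^sub>R y) \<in> span (a ` I)" using uv by simp
  qed
  moreover have "orbit I \<mu> \<subseteq> ?U"
  proof (rule orbit_subset)
    fix y i assume "y \<in> ?U" "i \<in> I"
    then have "(\<mu> - y) + p y (c i) *\<^sub>R a i \<in> span (a ` I)"
      by (intro span_add[OF _ span_scale[OF span_base]]) auto
    then show "r i y \<in> ?U" by (simp add: reflection_def algebra_simps)
  qed (simp add: span_zero)
  ultimately have "affine hull (convex hull (orbit I \<mu>)) \<subseteq> ?U"
    by (simp add: affine_hull_convex_hull hull_minimal)
  then show ?thesis using assms by blast
qed

text \<open>The strict inequalities define an open set, and its part inside the affine hull is in
  the face by \<open>regular_in_hull\<close>.\<close>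

lemma regular_in_rel_interior:
  assumes conn: "positivity_spreads I \<mu>"
    and \<mu>: "\<forall>i\<in>I. 0 \<le> p \<mu> (c i)"
    and \<eta>: "\<mu> - \<eta> \<in> span (a ` I)" "\<forall>i\<in>I. 0 < coord i (\<mu> - \<eta>)" "\<forall>i\<in>I. 0 < p \<eta> (c i)"
  shows "\<eta> \<in> rel_interior (convex hull (orbit I \<mu>))"
proof -
  let ?T = "(\<Inter>i\<in>I. {z. 0 < coord i (\<mu> - z)}) \<inter> (\<Inter>i\<in>I. {z. 0 < p z (c i)})"
  have cont: "continuous_on UNIV (\<lambda>z. coord i (\<mu> - z))" "continuous_on UNIV (\<lambda>z. p z (c i))" for i
  proof -
    show "continuous_on UNIV (\<lambda>z. p z (c i))"
      using linear_p linear_conv_bounded_linear linear_continuous_on by blast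
    have "continuous_on UNIV (coord i)"
      using coord(1) linear_conv_bounded_linear linear_continuous_on by blast
    then show "continuous_on UNIV (\<lambda>z. coord i (\<mu> - z))"
      unfolding coord_linear by (intro continuous_on_diff continuous_on_const)
  qed
  have "open ?T"
    by (intro open_Int open_INT ballI open_Collect_less cont continuous_on_const finite)
  moreover have "\<eta> \<in> ?T" using \<eta> by auto
  moreover have "?T \<inter> affine hull (convex hull (orbit I \<mu>)) \<subseteq> convex hull (orbit I \<mu>)"
    using affine_hull_in_span regular_in_hull[OF conn \<mu>] by auto
  ultimately show ?thesis
    unfolding mem_rel_interior using regular_in_hull[OF conn \<mu> \<eta>] by blast
qed

lemma dominant_in_rel_interior:
  assumes conn: "positivity_spreads I \<mu>"
    and \<mu>: "\<forall>i\<in>I. 0 \<le> p \<mu> (c i)"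
    and \<eta>: "\<mu> - \<eta> \<in> span (a ` I)" "\<forall>i\<in>I. 0 < coord i (\<mu> - \<eta>)" "\<forall>i\<in>I. 0 \<le> p \<eta> (c i)"
    and J: "positive_type {i \<in> I. p \<eta> (c i) = 0}"
  shows "\<eta> \<in> rel_interior (convex hull (orbit I \<mu>))"
proof -
  define J where "J = {i \<in> I. p \<eta> (c i) = 0}"
  have J': "positive_type J" "J \<subseteq> I" using J by (auto simp: J_def)
  obtain y where y: "\<forall>k\<in>J. (\<Sum>l\<in>J. B k l * y l) = 1"
    using positive_type_solvable[OF J'(1), of "\<lambda>_. 1"] by blast
  define v where "v = (\<Sum>l\<in>J. y l *\<^sub>R a l)"
  have v: "v \<in> span (a ` J)" unfolding v_def by (rule sum_in_span)
  have pv: "p v (c k) = 1" if "k \<in> J" for k using y that by (simp add: v_def mult.commute)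
  \<comment> \<open>Coordinates must survive the perturbation for all of \<open>I\<close>. Values on
    coroots need protection only outside \<open>J\<close>, since on \<open>J\<close> they become
    \<open>e\<close>.\<close>
  have "\<exists>e>0. e \<le> 1 \<and> (\<forall>i\<in>I. e * (\<bar>coord i v\<bar> + \<bar>p v (c i)\<bar>) <
      (if i \<in> J then coord i (\<mu> - \<eta>) else min (coord i (\<mu> - \<eta>)) (p \<eta> (c i))))"
    using \<eta> by (intro small_multiple) (auto simp: J_def less_le)
  then obtain e where e: "0 < e"
    "\<And>i. i \<in> I \<Longrightarrow> e * (\<bar>coord i v\<bar> + \<bar>p v (c i)\<bar>) <
      (if i \<in> J then coord i (\<mu> - \<eta>) else min (coord i (\<mu> - \<eta>)) (p \<eta> (c i)))" by blast
  have vI: "v \<in> span (a ` I)" using v span_mono[of "a ` J" "a ` I"] J'(2) by blast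
  have "\<eta> + e *\<^sub>R v \<in> rel_interior (convex hull (orbit I \<mu>))"
  proof (rule regular_in_rel_interior[OF conn \<mu>])
    have "\<mu> - (\<eta> + e *\<^sub>R v) = (\<mu> - \<eta>) - e *\<^sub>R v" by simp
    then show "\<mu> - (\<eta> + e *\<^sub>R v) \<in> span (a ` I)" using \<eta>(1) vI by (simp only: span_diff span_scale)
    show "\<forall>i\<in>I. 0 < coord i (\<mu> - (\<eta> + e *\<^sub>R v))"
    proof
      fix i assume i: "i \<in> I"
      have "e * coord i v \<le> e * (\<bar>coord i v\<bar> + \<bar>p v (c i)\<bar>)" using e(1) by (intro mult_left_mono) auto
      also have "\<dots> < coord i (\<mu> - \<eta>)" using e(2)[OF i] by (auto split: if_splits)
      finally show "0 < coord i (\<mu> - (\<eta> + e *\<^sub>R v))" by simp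
    qed
    show "\<forall>i\<in>I. 0 < p (\<eta> + e *\<^sub>R v) (c i)"
    proof
      fix i assume i: "i \<in> I"
      show "0 < p (\<eta> + e *\<^sub>R v) (c i)"
      proof (cases "i \<in> J")
        case True
        then show ?thesis using pv e(1) by (simp add: J_def)
      next
        case False
        have "e * - p v (c i) \<le> e * (\<bar>coord i v\<bar> + \<bar>p v (c i)\<bar>)" using e(1) by (intro mult_left_mono) auto
        also have "\<dots> < p \<eta> (c i)" using e(2)[OF i] False by auto
        finally show ?thesis by simp
      qed
    qed
  qed
  moreover have inv: "invariant I (rel_interior (convex hull (orbit I \<mu>)))"
    by (intro invariant_rel_interior invariant_hull)
  ultimately obtain x where x: "x \<in> rel_interior (convex hull (orbit I \<mu>))"
    "x - (\<eta> + e *\<^sub>R v) \<in> span (a ` J)" "\<forall>i\<in>J. p x (c i) = 0"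
    using fixed_point_in_invariant[OF J'(1), of "rel_interior (convex hull (orbit I \<mu>))" "\<eta> + e *\<^sub>R v"]
      J'(2) unfolding invariant_def by blast
  have "x - \<eta> = (x - (\<eta> + e *\<^sub>R v)) + e *\<^sub>R v" by simp
  then have "x - \<eta> \<in> span (a ` J)" using x(2) v by (simp only: span_add span_scale)
  then have "x - \<eta> = 0"
    using x(3) by (intro span_zero_of_p_zero[OF J'(1)]) (auto simp: J_def)
  then show ?thesis using x(1) by simp
qed

text \<open>From a point of the relative interior one can overshoot slightly, away from any point of
  the face. If the coordinate were 0, overshooting away from a point where it is positive would make
  it negative.\<close>

lemma rel_interior_coord_pos:
  assumes conn: "positivity_spreads I \<mu>"
    and \<mu>: "\<forall>i\<in>I. 0 \<le> p \<mu> (c i)"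
    and \<eta>: "\<eta> \<in> rel_interior (convex hull (orbit I \<mu>))" and i: "i \<in> I"
  shows "0 < coord i (\<mu> - \<eta>)"
proof (rule ccontr)
  let ?F = "convex hull (orbit I \<mu>)"
  have \<mu>F: "\<mu> \<in> ?F" by (intro hull_inc orbit_self)
  have "0 \<le> coord i (\<mu> - \<eta>)"
    using \<eta> rel_interior_subset hull_in_cone[OF \<mu>] nonneg_cone_coord by blast
  moreover assume "\<not> 0 < coord i (\<mu> - \<eta>)"
  ultimately have 0: "coord i (\<mu> - \<eta>) = 0" by linarith
  obtain x where x: "x \<in> ?F" "0 < coord i (\<mu> - x)"
    using regular_point[OF conn \<mu> invariant_hull \<mu>F] i by blast
  obtain e where e: "e > 1" "(1 - e) *\<^sub>R x + e *\<^sub>R \<eta> \<in> ?F"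
    using \<eta> x(1) convex_rel_interior_iff[OF convex_convex_hull, of "orbit I \<mu>" \<eta>] by blast
  have "0 \<le> coord i (\<mu> - ((1 - e) *\<^sub>R x + e *\<^sub>R \<eta>))"
    using hull_in_cone[OF \<mu> e(2)] by (rule nonneg_cone_coord)
  also have "\<dots> = (1 - e) * coord i (\<mu> - x) + e * coord i (\<mu> - \<eta>)" by (simp add: algebra_simps)
  also have "\<dots> < 0" using 0 e(1) x(2) by (simp add: mult_neg_pos)
  finally show False by simp
qed

subsection \<open>Dynkin components and finite type\<close>

abbreviation component :: "'n set \<Rightarrow> 'n \<Rightarrow> 'n set" where
  "component K x \<equiv> (Restr (dynkin_adj A) K)\<^sup>* `` {x}"

lemma components_altdef: "components A K = component K ` K"
  unfolding components_def quotient_def by blast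

lemma sym_adj: "sym ((Restr (dynkin_adj A) K)\<^sup>*)"
  using A_sym0 by (intro sym_rtrancl symI) (auto simp: dynkin_adj_def)

lemma component_subset: "x \<in> K \<Longrightarrow> component K x \<subseteq> K"
proof
  fix y assume "x \<in> K" "y \<in> component K x"
  then have "(x, y) \<in> (Restr (dynkin_adj A) K)\<^sup>*" by simp
  then show "y \<in> K" by (induction rule: rtrancl_induct) (use \<open>x \<in> K\<close> in auto)
qed

lemma component_self: "x \<in> component K x"
  by simp

lemma component_eq: "y \<in> component K x \<Longrightarrow> component K y = component K x"
proof -
  assume "y \<in> component K x"
  then have xy: "(x, y) \<in> (Restr (dynkin_adj A) K)\<^sup>*" by simp
  then have yx: "(y, x) \<in> (Restr (dynkin_adj A) K)\<^sup>*" by (rule symD[OF sym_adj])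
  show ?thesis using rtrancl_trans[OF xy] rtrancl_trans[OF yx] by blast
qed

lemma component_closed:
  assumes "x \<in> K" "i \<in> component K x" "k \<in> K" "A $ i $ k \<noteq> 0"
  shows "k \<in> component K x"
proof (cases "i = k")
  case False
  have "i \<in> K" using component_subset assms(1,2) by blast
  then have "(i, k) \<in> Restr (dynkin_adj A) K"
    using assms(3,4) False A_sym0[of k i] by (auto simp: dynkin_adj_def)
  moreover have "(x, i) \<in> (Restr (dynkin_adj A) K)\<^sup>*" using assms(2) by simp
  ultimately have "(x, k) \<in> (Restr (dynkin_adj A) K)\<^sup>*" by (metis rtrancl.rtrancl_into_rtrancl)
  then show ?thesis by simp
qed (use assms in simp)

lemma component_connected:
  assumes "x \<in> K" "Z \<subseteq> component K x" "Z \<noteq> {}"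
    and closed: "\<And>i k. i \<in> Z \<Longrightarrow> k \<in> component K x \<Longrightarrow> A $ i $ k \<noteq> 0 \<Longrightarrow> k \<in> Z"
  shows "Z = component K x"
proof
  obtain z where z: "z \<in> Z" using assms(3) by blast
  show "component K x \<subseteq> Z"
  proof
    fix y assume y: "y \<in> component K x"
    have "component K z = component K x" using component_eq assms(2) z by blast
    then have "(z, y) \<in> (Restr (dynkin_adj A) K)\<^sup>*" using y by blast
    then show "y \<in> Z"
    proof (induction rule: rtrancl_induct)
      case (step i k)
      then have ik: "A $ i $ k \<noteq> 0" "k \<in> K"
        using A_sym0[of i k] by (auto simp: dynkin_adj_def)
      then have "k \<in> component K x"
        using component_closed assms(1,2) step.IH by blast
      then show ?case using closed step.IH ik(1) by blast
    qed (rule z)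
  qed
qed (rule assms(2))

lemma finite_part_eq_iff: "finite_part A K = K \<longleftrightarrow> (\<forall>x\<in>K. finite_type A (component K x))"
proof
  assume fp: "finite_part A K = K"
  show "\<forall>x\<in>K. finite_type A (component K x)"
  proof
    fix x assume "x \<in> K"
    then have "x \<in> finite_part A K" using fp by simp
    then obtain y where y: "y \<in> K" "x \<in> component K y" "finite_type A (component K y)"
      unfolding finite_part_def components_altdef by blast
    then show "finite_type A (component K x)" using component_eq[OF y(2)] by simp
  qed
next
  assume "\<forall>x\<in>K. finite_type A (component K x)"
  then show "finite_part A K = K"
    unfolding finite_part_def components_altdef using component_subset component_self by blast
qed

text \<open>The image of \<open>m\<close> may vanish in some rows; connectedness makes up for this
  by carrying information from the one positive row to all others.\<close>

lemma indecomposable_finite_type: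
  assumes x: "x \<in> K" and L: "L = component K x"
    and m: "\<forall>i\<in>L. 0 < m i" "\<forall>i\<in>L. 0 \<le> (\<Sum>j\<in>L. B i j * m j)" "\<exists>i\<in>L. 0 < (\<Sum>j\<in>L. B i j * m j)"
  shows "finite_type A L"
proof -
  have L': "finite L" "L \<noteq> {}" using m(3) by auto
  have alt: "(\<forall>i\<in>L. 0 < v i) \<or> (\<forall>i\<in>L. v i = 0)" if v: "\<forall>i\<in>L. 0 \<le> (\<Sum>j\<in>L. B i j * v j)" for v
  proof -
    define i where "i = arg_min_on (\<lambda>i. v i / m i) L"
    define t where "t = v i / m i"
    have i: "i \<in> L" unfolding i_def using L' by (rule arg_min_if_finite)
    have t: "t * m l \<le> v l" if "l \<in> L" for l
    proof -
      have "t \<le> v l / m l" unfolding t_def i_def using L' that by (rule arg_min_least)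
      then show ?thesis using m(1) that by (simp add: pos_le_divide_eq)
    qed
    show ?thesis
    proof (cases "0 < t")
      case True
      have "0 < v l" if "l \<in> L" for l
      proof -
        have "0 < t * m l" using True m(1) that by simp
        then show ?thesis using t[OF that] by linarith
      qed
      then show ?thesis by blast
    next
      case False
      define w where "w j = v j - t * m j" for j
      have w: "\<forall>j\<in>L. 0 \<le> w j" using t by (simp add: w_def)
      have rw: "(\<Sum>j\<in>L. B k j * w j) = (\<Sum>j\<in>L. B k j * v j) - t * (\<Sum>j\<in>L. B k j * m j)" for k
        unfolding w_def by (simp add: right_diff_distrib sum_subtractf sum_distrib_left mult.left_commute)
      have rw_nonneg: "0 \<le> (\<Sum>j\<in>L. B k j * w j)" if "k \<in> L" for k
      proof -
        have "t * (\<Sum>j\<in>L. B k j * m j) \<le> 0" using False m(2) that by (simp add: mult_nonpos_nonneg)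
        then show ?thesis unfolding rw using v that by force
      qed
      \<comment> \<open>At a zero of \<open>w\<close> all terms of its row are nonpositive while
        their sum is nonnegative, so neighbours of zeros are zeros. Hence \<open>v\<close> is a
        multiple of \<open>m\<close>, and the positive row of \<open>m\<close> leaves only the
        factor 0.\<close>
      have "{j \<in> L. w j = 0} = L"
        unfolding L
      proof (rule component_connected[OF x])
        show "{j \<in> component K x. w j = 0} \<subseteq> component K x" by blast
        have "m i \<noteq> 0" using m(1) i by force
        then have "w i = 0" by (simp add: w_def t_def)
        then show "{j \<in> component K x. w j = 0} \<noteq> {}" using i L by blast
        fix k l assume k: "k \<in> {j \<in> component K x. w j = 0}" and l: "l \<in> component K x" "A $ k $ l \<noteq> 0"
        have kl: "k \<in> L" "w k = 0" "l \<in> L" using k l L by auto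
        have le: "B k j * w j \<le> 0" if "j \<in> L" for j
          using w that kl(2) B_off[of k j] by (cases "j = k") (auto simp: mult_nonpos_nonneg)
        have "(\<Sum>j\<in>L. - (B k j * w j)) = 0"
          using rw_nonneg[OF kl(1)] sum_nonpos[of L "\<lambda>j. B k j * w j"] le by (simp add: sum_negf)
        then have "\<forall>j\<in>L. - (B k j * w j) = 0"
          using le L'(1) by (subst (asm) sum_nonneg_eq_0_iff) auto
        then have "B k l * w l = 0" using kl(3) by force
        then have "w l = 0" using l(2) by simp
        then show "l \<in> {j \<in> component K x. w j = 0}" using l by simp
      qed
      then have w0: "\<forall>j\<in>L. w j = 0" by blast
      obtain k where k: "k \<in> L" "0 < (\<Sum>j\<in>L. B k j * m j)" using m(3) by blast
      have "(\<Sum>j\<in>L. B k j * w j) = 0" using w0 by simp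
      moreover have "0 \<le> (\<Sum>j\<in>L. B k j * v j)" using v k(1) by blast
      ultimately have "0 \<le> t * (\<Sum>j\<in>L. B k j * m j)" using rw[of k] by linarith
      then have "t = 0" using False k(2) by (simp add: zero_le_mult_iff)
      then show ?thesis using w0 by (simp add: w_def)
    qed
  qed
  have ker: "\<forall>i\<in>L. v i = 0" if "\<forall>i\<in>L. (\<Sum>j\<in>L. B i j * v j) = 0" for v
  proof -
    have "(\<forall>i\<in>L. 0 < v i) \<or> (\<forall>i\<in>L. v i = 0)" using that by (intro alt) simp
    moreover have "(\<forall>i\<in>L. 0 < - v i) \<or> (\<forall>i\<in>L. - v i = 0)"
      using that by (intro alt[of "\<lambda>i. - v i"]) (simp add: sum_negf)
    ultimately show ?thesis using L'(2) by force
  qed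
  \<comment> \<open>Solving for the constant vector 1 yields a strictly positive image, and
    \<open>alt\<close> makes the solution itself positive.\<close>
  obtain u where u: "\<forall>i\<in>L. (\<Sum>j\<in>L. B i j * u j) = 1" using solvable[of L "\<lambda>_. 1"] ker by blast
  have "\<not> (\<forall>i\<in>L. u i = 0)"
  proof
    assume "\<forall>i\<in>L. u i = 0"
    then have "(\<Sum>j\<in>L. B i j * u j) = 0" for i by simp
    then show False using u L'(2) by force
  qed
  moreover have "(\<forall>i\<in>L. 0 < u i) \<or> (\<forall>i\<in>L. u i = 0)" using u by (intro alt) simp
  ultimately have "\<forall>i\<in>L. 0 < u i" by blast
  moreover have "principal_minor A L \<noteq> 0" using ker by (rule principal_minor_nonzero)
  ultimately show ?thesis unfolding finite_type_def using alt u by (auto intro!: exI[of _ u])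
qed

text \<open>Entries between different components vanish, so vectors for the components can be
  glued.\<close>

lemma finite_part_positive_type:
  assumes "finite_part A J = J"
  shows "positive_type J"
proof -
  have "\<forall>x\<in>J. finite_type A (component J x)"
    using assms finite_part_eq_iff[of J] by blast
  then have "\<forall>x\<in>J. \<exists>u :: 'n \<Rightarrow> real. (\<forall>i\<in>component J x. 0 < u i) \<and>
      (\<forall>i\<in>component J x. 0 < (\<Sum>j\<in>component J x. B i j * u j))"
    unfolding finite_type_def by blast
  from bchoice[OF this] obtain U :: "'n \<Rightarrow> 'n \<Rightarrow> real"
    where "\<forall>x\<in>J. (\<forall>i\<in>component J x. 0 < U x i) \<and>
      (\<forall>i\<in>component J x. 0 < (\<Sum>j\<in>component J x. B i j * U x j))" by blast
  then have U: "\<And>x i. x \<in> J \<Longrightarrow> i \<in> component J x \<Longrightarrow> 0 < U x i"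
    "\<And>x i. x \<in> J \<Longrightarrow> i \<in> component J x \<Longrightarrow> 0 < (\<Sum>j\<in>component J x. B i j * U x j)"
    by blast+
  \<comment> \<open>The chosen vectors are indexed by elements; one representative per component
    makes the glued vector consistent.\<close>
  define rep where "rep L = (SOME x. x \<in> J \<and> component J x = L)" for L
  have rep: "rep (component J i) \<in> J" "component J (rep (component J i)) = component J i"
    if "i \<in> J" for i
    using someI[of "\<lambda>x. x \<in> J \<and> component J x = component J i" i] that unfolding rep_def by blast+
  define u where "u i = U (rep (component J i)) i" for i
  have "0 < u i" if "i \<in> J" for i 
    unfolding u_def using rep[OF that] component_self by (intro U(1)) auto
  moreover have "0 < (\<Sum>j\<in>J. B i j * u j)" if i: "i \<in> J" for i
  proof -
    let ?L = "component J i"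
    have "(\<Sum>j\<in>J. B i j * u j) = (\<Sum>j\<in>?L. B i j * U (rep ?L) j)"
    proof (rule sum.mono_neutral_cong_right)
      show "?L \<subseteq> J" using i by (rule component_subset)
      show "\<forall>j\<in>J - ?L. B i j * u j = 0" using component_closed[OF i] component_self[of i J] by fastforce
      show "B i j * u j = B i j * U (rep ?L) j" if "j \<in> ?L" for j
        using component_eq[OF that] by (simp add: u_def)
    qed simp
    then show ?thesis using U(2)[of "rep ?L" i] rep[OF i] component_self[of i J] by simp
  qed
  ultimately show ?thesis unfolding positive_type_def by blast
qed

section \<open>From Dynkin components to signs on the coroots\<close>

text \<open>If no edge led into \<open>Z\<close> from its complement in \<open>I\<close>, a
  component meeting the complement would avoid \<open>Z\<close>, hence all indices where \<mu> is
  positive.\<close>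

lemma mu_connected_spreads:
  assumes \<mu>: "\<mu> \<in> fundamental_chamber p c" and conn: "mu_connected A p c \<mu> I"
  shows "positivity_spreads I \<mu>"
  unfolding positivity_spreads_def
proof (intro allI impI, rule ccontr)
  fix Z assume Z: "{i \<in> I. 0 < p \<mu> (c i)} \<subseteq> Z" "Z \<subset> I" and no: "\<not> (\<exists>i\<in>I - Z. \<exists>k\<in>Z. A $ i $ k \<noteq> 0)"
  obtain x where x: "x \<in> I" "x \<notin> Z" using Z(2) by blast
  let ?L = "component I x"
  have L: "?L \<subseteq> I" using x(1) by (rule component_subset)
  have "?L - Z = ?L"
  proof (rule component_connected[OF x(1)])
    show "?L - Z \<noteq> {}" using x component_self[of x I] by blast
    fix i k assume "i \<in> ?L - Z" "k \<in> ?L" "A $ i $ k \<noteq> 0"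
    then show "k \<in> ?L - Z" using no L by blast
  qed blast
  then have "?L \<subseteq> I - {i \<in> I. 0 < p \<mu> (c i)}" using Z(1) L by blast
  then have "?L \<subseteq> zero_set p c \<mu>"
    using \<mu> by (auto simp: zero_set_def fundamental_chamber_def less_le)
  moreover have "?L \<in> components A I" using x(1) by (auto simp: components_altdef)
  ultimately show False using conn unfolding mu_connected_def by blast
qed

lemma mu_minus_iff: "\<eta> \<in> mu_minus a \<mu> I \<longleftrightarrow> \<mu> - \<eta> \<in> span (a ` I) \<and> (\<forall>i\<in>I. 0 < coord i (\<mu> - \<eta>))"
proof
  assume "\<eta> \<in> mu_minus a \<mu> I"
  then obtain m where m: "\<forall>i\<in>I. 0 < m i" "\<mu> - \<eta> = (\<Sum>i\<in>I. m i *\<^sub>R a i)"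
    by (auto simp: mu_minus_def pos_combs_def)
  have "coord i (\<mu> - \<eta>) = m i" if "i \<in> I" for i
    unfolding m(2) using that by (simp only: coord_sum finite if_True)
  then show "\<mu> - \<eta> \<in> span (a ` I) \<and> (\<forall>i\<in>I. 0 < coord i (\<mu> - \<eta>))"
    using m sum_in_span[of m I] by (simp del: coord_linear)
next
  assume \<eta>: "\<mu> - \<eta> \<in> span (a ` I) \<and> (\<forall>i\<in>I. 0 < coord i (\<mu> - \<eta>))"
  have "\<mu> - \<eta> \<in> pos_combs a I"
    unfolding pos_combs_def mem_Collect_eq
    using \<eta> span_coord by (intro exI[of _ "\<lambda>i. coord i (\<mu> - \<eta>)"] conjI) (auto simp del: coord_linear)
  then show "\<eta> \<in> mu_minus a \<mu> I" unfolding mu_minus_def by (intro image_eqI[where x = "\<mu> - \<eta>"]) auto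
qed

text \<open>Applied to \<open>a j\<close>, the two products have the \<open>a i\<close>-coefficients
  \<open>A $ i $ j\<close> and its negative.\<close>

lemma reflections_commute_iff:
  assumes "i \<noteq> j"
  shows "r i \<circ> r j = r j \<circ> r i \<longleftrightarrow> A $ i $ j = 0"
proof
  assume "r i \<circ> r j = r j \<circ> r i"
  then have "r i (r j (a j)) = r j (r i (a j))" by (metis comp_apply)
  then have "coord i (r i (r j (a j))) = coord i (r j (r i (a j)))" by simp
  then show "A $ i $ j = 0" using assms by (simp add: reflection_def)
next
  assume "A $ i $ j = 0"
  then show "r i \<circ> r j = r j \<circ> r i"
    using A_sym0[of i j] by (simp add: fun_eq_iff reflection_def)
qed

lemma star_set_altdef: "star_set p a c \<mu> I = {i. i \<notin> I \<and> p \<mu> (c i) = 0 \<and> (\<forall>j\<in>I. A $ i $ j = 0)}"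
proof -
  have "(r i \<circ> r j = r j \<circ> r i) = (A $ i $ j = 0)" if "i \<notin> I" "j \<in> I" for i j
    using that by (intro reflections_commute_iff) auto
  then show ?thesis unfolding star_set_def zero_set_def by auto
qed

text \<open>Outside \<open>I\<close> the value is that of \<mu> plus nonnegative contributions of
  neighbours in \<open>I\<close>. It vanishes exactly if \<mu> vanishes and there are no such
  neighbours, which explains the star set in the chamber faces.\<close>

lemma mu_minus_outside:
  assumes \<mu>: "\<mu> \<in> fundamental_chamber p c" and \<eta>: "\<eta> \<in> mu_minus a \<mu> I" and i: "i \<notin> I"
  shows "if i \<in> star_set p a c \<mu> I then p \<eta> (c i) = 0 else 0 < p \<eta> (c i)"
proof -
  have \<eta>': "\<mu> - \<eta> \<in> span (a ` I)" "\<forall>i\<in>I. 0 < coord i (\<mu> - \<eta>)" using \<eta> by (auto simp: mu_minus_iff simp del: coord_linear)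
  have \<mu>i: "0 \<le> p \<mu> (c i)" using \<mu> by (simp add: fundamental_chamber_def)
  have eq: "p \<eta> (c i) = p \<mu> (c i) + (\<Sum>k\<in>I. - (B i k * coord k (\<mu> - \<eta>)))"
    by (subst p_below[OF \<eta>'(1)]) (simp add: sum_negf del: coord_linear)
  have nn: "0 \<le> - (B i k * coord k (\<mu> - \<eta>))" if "k \<in> I" for k
  proof -
    have "B i k \<le> 0" "0 \<le> coord k (\<mu> - \<eta>)" using that i B_off[of i k] \<eta>'(2) less_imp_le by blast+
    then show ?thesis by (simp add: mult_nonpos_nonneg del: coord_linear)
  qed
  have sum_nn: "0 \<le> (\<Sum>k\<in>I. - (B i k * coord k (\<mu> - \<eta>)))" using nn by (rule sum_nonneg)
  show ?thesis
  proof (cases "i \<in> star_set p a c \<mu> I")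
    case True
    then show ?thesis using eq by (simp add: star_set_altdef)
  next
    case False
    have "0 < p \<eta> (c i)"
    proof (cases "p \<mu> (c i) = 0")
      case True
      then obtain k where k: "k \<in> I" "A $ i $ k \<noteq> 0" using False i by (auto simp: star_set_altdef)
      then have "B i k < 0" using A_off[of i k] i by (cases "i = k") (auto simp: less_le)
      then have "0 < - (B i k * coord k (\<mu> - \<eta>))" using \<eta>'(2) k(1) by (simp add: mult_neg_pos del: coord_linear)
      also have "\<dots> \<le> (\<Sum>k\<in>I. - (B i k * coord k (\<mu> - \<eta>)))" using k(1) nn by (intro member_le_sum) auto
      finally show ?thesis using eq \<mu>i by linarith
    qed (use eq \<mu>i sum_nn in linarith)
    then show ?thesis using False by simp
  qed
qed

text \<open>On a component \<open>L\<close> of the zeros, the block of \<open>L\<close> sends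
  \<open>m\<close> to the values of \<mu> plus contributions of \<open>I - L\<close>, all
  nonnegative. If all vanished, \<open>L\<close> would have no neighbours in \<open>I - L\<close>
  and \<mu> would vanish on it, so some component of \<open>I\<close> would violate
  \<open>conn\<close>.\<close>

lemma zeros_finite_part:
  assumes \<mu>: "\<mu> \<in> fundamental_chamber p c" and conn: "mu_connected A p c \<mu> I"
    and \<eta>: "\<eta> \<in> mu_minus a \<mu> I"
  defines "J \<equiv> {i \<in> I. p \<eta> (c i) = 0}"
  shows "finite_part A J = J"
proof -
  define m where "m i = coord i (\<mu> - \<eta>)" for i
  have m: "\<mu> - \<eta> \<in> span (a ` I)" "\<forall>i\<in>I. 0 < m i" using \<eta> by (auto simp: mu_minus_iff m_def simp del: coord_linear)
  have "finite_type A (component J x)" if x: "x \<in> J" for x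
  proof -
    define L where "L = component J x"
    have L: "L \<subseteq> J" "L \<subseteq> I" using component_subset[OF x] by (auto simp: L_def J_def)
    have row: "(\<Sum>k\<in>L. B i k * m k) = p \<mu> (c i) + (\<Sum>k\<in>I - L. - B i k * m k)" if "i \<in> L" for i
    proof -
      have "0 = p \<mu> (c i) - (\<Sum>k\<in>I. B i k * m k)"
        using p_below[OF m(1), of i] that L by (auto simp: J_def m_def simp del: coord_linear)
      moreover have "(\<Sum>k\<in>I. B i k * m k) = (\<Sum>k\<in>I - L. B i k * m k) + (\<Sum>k\<in>L. B i k * m k)"
        using L(2) by (intro sum.subset_diff) auto
      ultimately show ?thesis by (simp add: sum_negf)
    qed
    have off: "0 \<le> - B i k * m k" if "i \<in> L" "k \<in> I - L" for i k
    proof -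
      have "B i k \<le> 0" "0 \<le> m k" using that B_off[of i k] m(2) less_imp_le by blast+
      then show ?thesis by (simp add: mult_nonpos_nonneg)
    qed
    have \<mu>nn: "0 \<le> p \<mu> (c i)" for i using \<mu> by (simp add: fundamental_chamber_def)
    have "\<exists>i\<in>L. 0 < (\<Sum>k\<in>L. B i k * m k)"
    proof (rule ccontr)
      assume none: "\<not> (\<exists>i\<in>L. 0 < (\<Sum>k\<in>L. B i k * m k))"
      have zero: "p \<mu> (c i) = 0" "\<forall>k\<in>I - L. A $ i $ k = 0" if i: "i \<in> L" for i
      proof -
        have nn: "0 \<le> (\<Sum>k\<in>I - L. - B i k * m k)" using off[OF i] by (rule sum_nonneg)
        have le: "p \<mu> (c i) + (\<Sum>k\<in>I - L. - B i k * m k) \<le> 0"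
          using none i unfolding row[OF i, symmetric] by force
        show "p \<mu> (c i) = 0" using nn le \<mu>nn[of i] by linarith
        have "(\<Sum>k\<in>I - L. - B i k * m k) = 0" using nn le \<mu>nn[of i] by linarith
        then have "\<forall>k\<in>I - L. - B i k * m k = 0"
          using off[OF i] by (subst (asm) sum_nonneg_eq_0_iff) auto
        then show "\<forall>k\<in>I - L. A $ i $ k = 0" using m(2) by force
      qed
      have xI: "x \<in> I" using x by (simp add: J_def)
      let ?M = "component I x"
      have "L \<inter> ?M = ?M"
      proof (rule component_connected[OF xI])
        show "L \<inter> ?M \<noteq> {}" using component_self[of x] by (auto simp: L_def)
        fix i k assume "i \<in> L \<inter> ?M" "k \<in> ?M" "A $ i $ k \<noteq> 0"
        then show "k \<in> L \<inter> ?M" using zero(2)[of i] component_subset[OF xI] by blast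
      qed blast
      then have "?M \<subseteq> zero_set p c \<mu>" using zero(1) by (auto simp: zero_set_def)
      moreover have "?M \<in> components A I" using xI by (auto simp: components_altdef)
      ultimately show False using conn unfolding mu_connected_def by blast
    qed
    moreover have "\<forall>i\<in>L. 0 \<le> (\<Sum>k\<in>L. B i k * m k)"
    proof
      fix i assume i: "i \<in> L"
      have "0 \<le> (\<Sum>k\<in>I - L. - B i k * m k)" using off[OF i] by (rule sum_nonneg)
      then show "0 \<le> (\<Sum>k\<in>L. B i k * m k)" unfolding row[OF i] using \<mu>nn[of i] by linarith
    qed
    moreover have "\<forall>i\<in>L. 0 < m i" using m(2) L(2) by blast
    ultimately show ?thesis using indecomposable_finite_type[OF x L_def, of m] by (simp add: L_def)
  qed
  then show ?thesis using finite_part_eq_iff[of J] by blast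
qed

section \<open>The statements about the face\<close>

lemma face_eq: "face p a c \<mu> I = convex hull (orbit I \<mu>)"
  by (simp add: face_def weyl_subgroup_eq_words orbit_def image_image)

lemma rel_interior_face_chamber:
  assumes \<mu>: "\<mu> \<in> fundamental_chamber p c" and conn: "mu_connected A p c \<mu> I"
  shows "rel_interior (face p a c \<mu> I) \<inter> fundamental_chamber p c =
    mu_minus a \<mu> I \<inter> fundamental_chamber p c"
proof -
  note spreads = mu_connected_spreads[OF assms]
  have dom: "\<forall>i\<in>I. 0 \<le> p \<mu> (c i)" using \<mu> by (simp add: fundamental_chamber_def)
  show ?thesis
  proof (intro equalityI subsetI IntI; elim IntE)
    fix \<eta> assume \<eta>: "\<eta> \<in> rel_interior (face p a c \<mu> I)" "\<eta> \<in> fundamental_chamber p c"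
    then have "\<eta> \<in> convex hull (orbit I \<mu>)" using rel_interior_subset by (auto simp: face_eq)
    then have "\<mu> - \<eta> \<in> span (a ` I)" using hull_in_cone[OF dom] by (simp add: nonneg_cone_def)
    then show "\<eta> \<in> mu_minus a \<mu> I"
      unfolding mu_minus_iff using rel_interior_coord_pos[OF spreads dom] \<eta>(1) by (simp add: face_eq del: coord_linear)
  next
    fix \<eta> assume \<eta>: "\<eta> \<in> mu_minus a \<mu> I" "\<eta> \<in> fundamental_chamber p c"
    have "positive_type {i \<in> I. p \<eta> (c i) = 0}"
      using zeros_finite_part[OF assms \<eta>(1)] by (rule finite_part_positive_type)
    moreover have "\<forall>i\<in>I. 0 \<le> p \<eta> (c i)" using \<eta>(2) by (simp add: fundamental_chamber_def)
    ultimately show "\<eta> \<in> rel_interior (face p a c \<mu> I)"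
      unfolding face_eq using \<eta>(1)[unfolded mu_minus_iff] dominant_in_rel_interior[OF spreads dom] by blast
  qed
qed

lemma rel_interior_face_eq_orbits:
  assumes \<mu>: "\<mu> \<in> fundamental_chamber p c"
  shows "rel_interior (face p a c \<mu> I) =
    (\<Union>w\<in>weyl_subgroup p a c I. w ` (rel_interior (face p a c \<mu> I) \<inter> fundamental_chamber p c))"
proof -
  have dom: "\<forall>i\<in>I. 0 \<le> p \<mu> (c i)" using \<mu> by (simp add: fundamental_chamber_def)
  let ?R = "rel_interior (convex hull (orbit I \<mu>))"
  have inv: "orbit I y \<subseteq> ?R" if "y \<in> ?R" for y
    using invariant_rel_interior[OF invariant_hull, of I \<mu>] that
    by (intro orbit_subset) (auto simp: invariant_def)
  have "\<exists>w\<in>lists I. \<exists>z\<in>?R \<inter> fundamental_chamber p c. y = foldr r w z" if y: "y \<in> ?R" for y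
  proof -
    have yF: "y \<in> convex hull (orbit I \<mu>)" using y rel_interior_subset by blast
    obtain z where z: "z \<in> orbit I y" "\<forall>j\<in>I. 0 \<le> p z (c j)" using hull_conjugate[OF dom yF] by blast
    have zR: "z \<in> ?R" using inv[OF y] z(1) by blast
    have "z \<in> convex hull (orbit I \<mu>)" using zR rel_interior_subset by blast
    then have cone: "\<mu> - z \<in> nonneg_cone I" by (rule hull_in_cone[OF dom])
    \<comment> \<open>\<open>hull_conjugate\<close> gives dominance on \<open>I\<close> only.
      Outside \<open>I\<close> it is automatic: subtracting roots of \<open>I\<close> from \<mu>
      cannot decrease those values.\<close>
    have "0 \<le> p z (c i)" if i: "i \<notin> I" for i
    proof -
      have "(\<Sum>k\<in>I. B i k * coord k (\<mu> - z)) \<le> 0"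
      proof (rule sum_nonpos)
        fix k assume "k \<in> I"
        then have "B i k \<le> 0" using B_off[of i k] i by blast
        then show "B i k * coord k (\<mu> - z) \<le> 0"
          using nonneg_cone_coord[OF cone] by (rule mult_nonpos_nonneg)
      qed
      moreover have "p z (c i) = p \<mu> (c i) - (\<Sum>k\<in>I. B i k * coord k (\<mu> - z))"
        using cone by (intro p_below) (simp add: nonneg_cone_def)
      moreover have "0 \<le> p \<mu> (c i)" using \<mu> by (simp add: fundamental_chamber_def)
      ultimately show ?thesis by linarith
    qed
    then have "z \<in> fundamental_chamber p c" using z(2) by (auto simp: fundamental_chamber_def)
    moreover obtain w where "w \<in> lists I" "y = foldr r w z" using orbit_sym[OF z(1)] by (auto simp: orbit_def)
    ultimately show ?thesis using zR by blast
  qed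
  moreover have "foldr r w z \<in> ?R" if "w \<in> lists I" "z \<in> ?R" for w z
    using inv[OF that(2)] that(1) by (auto simp: orbit_def)
  ultimately show ?thesis unfolding face_eq weyl_subgroup_eq_words by blast
qed

lemma mu_minus_chamber_decomposition:
  assumes \<mu>: "\<mu> \<in> fundamental_chamber p c" and conn: "mu_connected A p c \<mu> I"
  shows "mu_minus a \<mu> I \<inter> fundamental_chamber p c =
    (\<Union>J\<in>{J. J \<subseteq> I \<and> finite_part A J = J}. mu_minus a \<mu> I \<inter> chamber_face p c (star_set p a c \<mu> I \<union> J))"
proof (intro equalityI subsetI)
  fix \<eta> assume "\<eta> \<in> mu_minus a \<mu> I \<inter> fundamental_chamber p c"
  then have \<eta>: "\<eta> \<in> mu_minus a \<mu> I" "\<And>i. 0 \<le> p \<eta> (c i)" by (auto simp: fundamental_chamber_def)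
  let ?J = "{i \<in> I. p \<eta> (c i) = 0}"
  have out: "if i \<in> star_set p a c \<mu> I then p \<eta> (c i) = 0 else 0 < p \<eta> (c i)" if "i \<notin> I" for i
    using \<mu> \<eta>(1) that by (rule mu_minus_outside)
  have "i \<notin> I" if "i \<in> star_set p a c \<mu> I" for i using that by (simp add: star_set_altdef)
  then have "\<eta> \<in> chamber_face p c (star_set p a c \<mu> I \<union> ?J)"
    unfolding chamber_face_def using out \<eta>(2) by (force simp: less_le)
  then show "\<eta> \<in> (\<Union>J\<in>{J. J \<subseteq> I \<and> finite_part A J = J}. mu_minus a \<mu> I \<inter> chamber_face p c (star_set p a c \<mu> I \<union> J))"
    using \<eta>(1) zeros_finite_part[OF assms \<eta>(1)] by (intro UN_I[of ?J]) auto
next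
  have "chamber_face p c J \<subseteq> fundamental_chamber p c" for J
  proof
    fix \<eta> assume "\<eta> \<in> chamber_face p c J"
    then have "0 \<le> p \<eta> (c i)" for i
      by (cases "i \<in> J") (auto simp: chamber_face_def less_imp_le)
    then show "\<eta> \<in> fundamental_chamber p c" by (simp add: fundamental_chamber_def)
  qed
  then show "\<eta> \<in> mu_minus a \<mu> I \<inter> fundamental_chamber p c"
    if "\<eta> \<in> (\<Union>J\<in>{J. J \<subseteq> I \<and> finite_part A J = J}. mu_minus a \<mu> I \<inter> chamber_face p c (star_set p a c \<mu> I \<union> J))" for \<eta>
    using that by blast
qed

lemma chamber_faces_disjoint:
  "disjoint_family_on (\<lambda>J. S \<inter> chamber_face p c (star_set p a c \<mu> I \<union> J)) {J. J \<subseteq> I \<and> finite_part A J = J}"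
proof -
  have "J \<subseteq> J'" if "x \<in> chamber_face p c (star_set p a c \<mu> I \<union> J)"
    "x \<in> chamber_face p c (star_set p a c \<mu> I \<union> J')" "J \<subseteq> I" for x J J'
  proof
    fix i assume i: "i \<in> J"
    then have "p x (c i) = 0" using that(1) by (simp add: chamber_face_def)
    then have "i \<in> star_set p a c \<mu> I \<union> J'" using that(2) unfolding chamber_face_def by force
    then show "i \<in> J'" using i that(3) by (auto simp: star_set_altdef)
  qed
  then show ?thesis unfolding disjoint_family_on_def by blast
qed

text \<open>Start from a point positive on all coroots of \<open>I\<close> and subtract the
  combination of roots of \<open>J\<close> that cancels its values on \<open>J\<close>. By inverse
  monotonicity the coefficients are nonnegative, so the other values and the coordinates of the
  difference from \<mu> only grow.\<close>

lemma mu_minus_chamber_face_nonempty: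
  assumes \<mu>: "\<mu> \<in> fundamental_chamber p c" and conn: "mu_connected A p c \<mu> I"
    and J: "J \<subseteq> I" "finite_part A J = J"
  shows "mu_minus a \<mu> I \<inter> chamber_face p c (star_set p a c \<mu> I \<union> J) \<noteq> {}"
proof -
  have dom: "\<forall>i\<in>I. 0 \<le> p \<mu> (c i)" using \<mu> by (simp add: fundamental_chamber_def)
  have "invariant I UNIV" by (simp add: invariant_def)
  then obtain x where x: "\<mu> - x \<in> span (a ` I)" "\<forall>i\<in>I. 0 < coord i (\<mu> - x) \<and> 0 < p x (c i)"
    using regular_point[OF mu_connected_spreads[OF \<mu> conn] dom, of UNIV] by blast
  have pt: "positive_type J" using J(2) by (rule finite_part_positive_type)
  then obtain y where y: "\<forall>k\<in>J. (\<Sum>l\<in>J. B k l * y l) = p x (c k)"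
    using positive_type_solvable[OF pt, of "\<lambda>k. p x (c k)"] by blast
  have "\<forall>i\<in>J. 0 \<le> (\<Sum>j\<in>J. B i j * y j)"
  proof
    fix i assume i: "i \<in> J"
    then have "0 < p x (c i)" using x(2) J(1) by blast
    then show "0 \<le> (\<Sum>j\<in>J. B i j * y j)" using y i by simp
  qed
  with pt have ynn: "\<forall>i\<in>J. 0 \<le> y i" by (rule positive_type_monotone)
  define \<eta> where "\<eta> = x - (\<Sum>l\<in>J. y l *\<^sub>R a l)"
  have "\<eta> \<in> mu_minus a \<mu> I"
    unfolding mu_minus_iff
  proof
    have eq: "\<mu> - \<eta> = (\<mu> - x) + (\<Sum>l\<in>J. y l *\<^sub>R a l)" by (simp add: \<eta>_def)
    have "(\<Sum>l\<in>J. y l *\<^sub>R a l) \<in> span (a ` I)"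
      using sum_in_span[of y J] span_mono[of "a ` J" "a ` I"] J(1) by blast
    then show "\<mu> - \<eta> \<in> span (a ` I)" unfolding eq using x(1) by (simp only: span_add)
    have "coord i (\<mu> - \<eta>) = coord i (\<mu> - x) + (if i \<in> J then y i else 0)" for i
      unfolding eq coord_linear(1) by (simp only: coord_sum finite)
    then show "\<forall>i\<in>I. 0 < coord i (\<mu> - \<eta>)"
      using x(2) ynn by (auto intro: add_pos_nonneg simp del: coord_linear)
  qed
  moreover have "\<eta> \<in> chamber_face p c (star_set p a c \<mu> I \<union> J)"
  proof -
    have p\<eta>: "p \<eta> (c i) = p x (c i) - (\<Sum>l\<in>J. B i l * y l)" for i
      by (simp add: \<eta>_def mult.commute)
    have onJ: "p \<eta> (c i) = 0" if "i \<in> J" for i using p\<eta> y that by simp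
    have offJ: "0 < p \<eta> (c i)" if i: "i \<in> I - J" for i
    proof -
      have "(\<Sum>l\<in>J. B i l * y l) \<le> 0"
      proof (rule sum_nonpos)
        fix l assume "l \<in> J"
        then have "B i l \<le> 0" "0 \<le> y l" using B_off[of i l] i ynn by auto
        then show "B i l * y l \<le> 0" by (rule mult_nonpos_nonneg)
      qed
      moreover have "0 < p x (c i)" using x(2) i by blast
      ultimately show ?thesis unfolding p\<eta> by linarith
    qed
    have out: "if i \<in> star_set p a c \<mu> I then p \<eta> (c i) = 0 else 0 < p \<eta> (c i)" if "i \<notin> I" for i
      using \<mu> \<open>\<eta> \<in> mu_minus a \<mu> I\<close> that by (rule mu_minus_outside)
    have star: "i \<notin> I" if "i \<in> star_set p a c \<mu> I" for i using that by (simp add: star_set_altdef)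
    show ?thesis
      unfolding chamber_face_def
    proof (intro CollectI conjI ballI)
      fix i assume "i \<in> star_set p a c \<mu> I \<union> J"
      then show "p \<eta> (c i) = 0" using out[of i] star[of i] onJ[of i] by auto
    next
      fix i assume "i \<in> - (star_set p a c \<mu> I \<union> J)"
      then show "0 < p \<eta> (c i)" using out[of i] offJ[of i] by (cases "i \<in> I") auto
    qed
  qed
  ultimately show ?thesis by blast
qed

end

lemma realization_cartan_datum:
  fixes p :: "'v::euclidean_space \<Rightarrow> 'h::real_vector \<Rightarrow> real"
  assumes "gen_cartan_matrix A" "realization A p a c"
  shows "cartan_datum A p a c"
proof (rule cartan_datum.intro)
  note real = assms(2)[unfolded realization_def dual_pairing_def]
  show "linear (\<lambda>\<eta>. p \<eta> h)" for h using real by blast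
  show "\<exists>\<Lambda>. \<forall>j. p \<Lambda> (c j) = (if j = k then 1 else 0)" for k
  proof -
    obtain f where f: "linear f" "\<forall>v\<in>range c. f v = (if v = c k then 1 else 0 :: real)"
      using linear_independent_extend[of "range c" "\<lambda>v. if v = c k then 1 else 0"] real by blast
    have "range p = {f. linear f}" using real bij_betw_imp_surj_on by blast
    then have "f \<in> range p" using f(1) by simp
    then obtain \<Lambda> where "p \<Lambda> = f" by (elim rangeE) simp
    moreover have "inj c" using real by blast
    ultimately show ?thesis using f(2) by (intro exI[of _ \<Lambda>]) (auto dest: injD)
  qed
qed (use assms in \<open>auto simp: realization_def\<close>)

theorem theorem3p9:
  fixes A :: "int^'n^'n"
    and p :: "'v::euclidean_space \<Rightarrow> 'h::real_vector \<Rightarrow> real"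
    and a :: "'n \<Rightarrow> 'v" and c :: "'n \<Rightarrow> 'h"
    and \<mu> :: 'v and I :: "'n set"
  assumes "gen_cartan_matrix A"
    and "realization A p a c"
    and "\<mu> \<in> fundamental_chamber p c"
    and "mu_connected A p c \<mu> I"
  shows "rel_interior (face p a c \<mu> I) =
           (\<Union>w\<in>weyl_subgroup p a c I. w ` (rel_interior (face p a c \<mu> I) \<inter> fundamental_chamber p c))
       \<and> rel_interior (face p a c \<mu> I) \<inter> fundamental_chamber p c =
           mu_minus a \<mu> I \<inter> fundamental_chamber p c
       \<and> mu_minus a \<mu> I \<inter> fundamental_chamber p c =
           (\<Union>J\<in>{J. J \<subseteq> I \<and> finite_part A J = J}.
              mu_minus a \<mu> I \<inter> chamber_face p c (star_set p a c \<mu> I \<union> J))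
       \<and> disjoint_family_on
           (\<lambda>J. mu_minus a \<mu> I \<inter> chamber_face p c (star_set p a c \<mu> I \<union> J))
           {J. J \<subseteq> I \<and> finite_part A J = J}
       \<and> (\<forall>J. J \<subseteq> I \<and> finite_part A J = J \<longrightarrow>
              mu_minus a \<mu> I \<inter> chamber_face p c (star_set p a c \<mu> I \<union> J) \<noteq> {})"
proof -
  interpret cartan_datum A p a c
    using assms(1,2) by (rule realization_cartan_datum)
  show ?thesis
    by (intro conjI allI impI rel_interior_face_eq_orbits rel_interior_face_chamber
        mu_minus_chamber_decomposition chamber_faces_disjoint mu_minus_chamber_face_nonempty
        assms(3,4)) auto
qed

end
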